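(* Let $b\in B^2(G,S^* )$ and suppose that the inertial group $H(b)$ of $b$ satisfies $H(b)\subsetneq G$. Then the weak crossed product order $\Lambda_b$ is not hereditary.
   Context: Standing assumptions: $R$ is a complete discrete valuation ring with quotient field $K$, $L$ is a finite Galois extension of $K$ with Galois group $G$, unramified with finite residue field; $S$ is the integral closure of $R$ in $L$, $\pi S$ its unique maximal ideal, $S^*=S\setminus\{0\}$, and $U(S)$ the group of units of $S$. For $\sigma\in G$ and $l\in L$ write $l^\sigma=\sigma(l)$; for a function $a$ with values in $L$, $a^\sigma(\tau)$ means $\sigma(a(\tau))$. $B^2(G,S^* )$ is the set of all functions $b:G\times G\to S^*$ for which there exists a function $a:G\to S^*$ with $a(1)=1$ such that $b(\sigma,\tau)=a(\sigma)a^{\sigma}(\tau)a(\sigma\tau)^{-1}$ for all $\sigma,\tau\in G$ (the inverse being taken in $L$). Its inertial group is $H(b)=\{\sigma\in G: b(\sigma,\sigma^{-1})\in U(S)\}$, which is a subgroup of $G$. $\Lambda_b=\bigoplus_{\sigma\in G}Sx_\sigma$ is the weak crossed product order associated to $b$: the free left $S$-module with basis the symbols $x_\sigma$, $\sigma\in G$, and multiplication determined by $x_\sigma s=s^{\sigma}x_\sigma$ and $x_\sigma x_\tau=b(\sigma,\tau)x_{\sigma\tau}$ for $\sigma,\tau\in G$, $s\in S$. It is an $R$-order in the crossed product $K$-algebra $A_b=\bigoplus_{\sigma\in G}Lx_\sigma$ (with multiplication given by the same rules). *)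

theory Defs
  imports "HOL-Algebra.Algebra"
begin

text \<open>Subrings and subfields of a ring \<open>L\<close> are sets; \<open>L\<lparr>carrier := R\<rparr>\<close> is the subring \<open>R\<close> regarded
  as a ring in its own right.\<close>

section \<open>Complete discrete valuation rings and unramified Galois extensions\<close>

definition discrete_valuation_ring :: "('a, 'm) ring_scheme \<Rightarrow> bool"
  where "discrete_valuation_ring R \<longleftrightarrow>
    principal_domain R \<and> \<not> field R \<and> (\<exists>!M. maximalideal M R)"

definition max_ideal :: "('a, 'm) ring_scheme \<Rightarrow> 'a set"
  where "max_ideal R = (THE M. maximalideal M R)"

text \<open>The power \<open>I [^]\<^bsub>ideals_set R\<^esub> n\<close> is the \<open>n\<close>-th power of \<open>I\<close> under the product of ideals.\<close>

definition adic_Cauchy :: "('a, 'm) ring_scheme \<Rightarrow> 'a set \<Rightarrow> (nat \<Rightarrow> 'a) \<Rightarrow> bool"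
  where "adic_Cauchy R I x \<longleftrightarrow>
    (\<forall>n::nat. \<exists>N. \<forall>i\<ge>N. \<forall>j\<ge>N. x i \<ominus>\<^bsub>R\<^esub> x j \<in> I [^]\<^bsub>ideals_set R\<^esub> n)"

definition adic_converges :: "('a, 'm) ring_scheme \<Rightarrow> 'a set \<Rightarrow> (nat \<Rightarrow> 'a) \<Rightarrow> 'a \<Rightarrow> bool"
  where "adic_converges R I x y \<longleftrightarrow>
    (\<forall>n::nat. \<exists>N. \<forall>i\<ge>N. x i \<ominus>\<^bsub>R\<^esub> y \<in> I [^]\<^bsub>ideals_set R\<^esub> n)"

definition complete_discrete_valuation_ring :: "('a, 'm) ring_scheme \<Rightarrow> bool"
  where "complete_discrete_valuation_ring R \<longleftrightarrow> discrete_valuation_ring R \<and>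
    (\<forall>x. range x \<subseteq> carrier R \<longrightarrow> adic_Cauchy R (max_ideal R) x \<longrightarrow>
         (\<exists>y\<in>carrier R. adic_converges R (max_ideal R) x y))"

definition fractions :: "('a, 'm) ring_scheme \<Rightarrow> 'a set \<Rightarrow> 'a set"
  where "fractions L R = {r \<otimes>\<^bsub>L\<^esub> inv\<^bsub>L\<^esub> s | r s. r \<in> R \<and> s \<in> R - {\<zero>\<^bsub>L\<^esub>}}"

text \<open>Following \<^const>\<open>BijGroup\<close>, automorphisms are normalised to be undefined outside the carrier,
  so that distinct elements of the group are distinct automorphisms.\<close>

definition galois_group :: "('a, 'm) ring_scheme \<Rightarrow> 'a set \<Rightarrow> ('a \<Rightarrow> 'a) monoid"
  where "galois_group L K =
    (BijGroup (carrier L))\<lparr>carrier :=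
       {\<sigma> \<in> extensional (carrier L). \<sigma> \<in> ring_iso L L \<and> (\<forall>x\<in>K. \<sigma> x = x)}\<rparr>"

definition finite_galois_extension :: "('a, 'm) ring_scheme \<Rightarrow> 'a set \<Rightarrow> bool"
  where "finite_galois_extension L K \<longleftrightarrow>
    field L \<and> subfield K L \<and> ring.finite_dimension L K (carrier L) \<and>
    {x \<in> carrier L. \<forall>\<sigma>\<in>carrier (galois_group L K). \<sigma> x = x} = K"

text \<open>Polynomials are lists of coefficients, leading coefficient first.\<close>

definition integral_closure :: "('a, 'm) ring_scheme \<Rightarrow> 'a set \<Rightarrow> 'a set"
  where "integral_closure L R =
    {x \<in> carrier L. \<exists>p \<in> carrier (R [X]\<^bsub>L\<^esub>). p \<noteq> [] \<and> hd p = \<one>\<^bsub>L\<^esub> \<and> ring.eval L p x = \<zero>\<^bsub>L\<^esub>}"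

text \<open>\<open>S\<close> is the integral closure of the complete discrete valuation ring \<open>R\<close> in a finite extension,
  hence local, and ramification index one means that the maximal ideal of \<open>R\<close> generates a maximal
  ideal of \<open>S\<close>.  Separability of the residue field extension, the other half of being unramified,
  is automatic because the residue field of \<open>R\<close> is finite, hence perfect.\<close>

definition unramified_finite_residue :: "('a, 'm) ring_scheme \<Rightarrow> 'a set \<Rightarrow> 'a set \<Rightarrow> bool"
  where "unramified_finite_residue L R S \<longleftrightarrow>
    finite (carrier (L\<lparr>carrier := R\<rparr> Quot max_ideal (L\<lparr>carrier := R\<rparr>))) \<and>
    maximalideal (genideal (L\<lparr>carrier := S\<rparr>) (max_ideal (L\<lparr>carrier := R\<rparr>))) (L\<lparr>carrier := S\<rparr>)"


section \<open>Coboundaries and weak crossed product orders\<close>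

definition coboundaries ::
    "('a, 'm) ring_scheme \<Rightarrow> ('a \<Rightarrow> 'a) monoid \<Rightarrow> 'a set \<Rightarrow> (('a \<Rightarrow> 'a) \<times> ('a \<Rightarrow> 'a) \<Rightarrow> 'a) set"
  where "coboundaries L G S =
    {b \<in> carrier G \<times> carrier G \<rightarrow> S - {\<zero>\<^bsub>L\<^esub>}.
      \<exists>a \<in> carrier G \<rightarrow> S - {\<zero>\<^bsub>L\<^esub>}. a \<one>\<^bsub>G\<^esub> = \<one>\<^bsub>L\<^esub> \<and>
        (\<forall>\<sigma>\<in>carrier G. \<forall>\<tau>\<in>carrier G.
           b (\<sigma>, \<tau>) = a \<sigma> \<otimes>\<^bsub>L\<^esub> \<sigma> (a \<tau>) \<otimes>\<^bsub>L\<^esub> inv\<^bsub>L\<^esub> (a (\<sigma> \<otimes>\<^bsub>G\<^esub> \<tau>)))}"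

definition inertial_group ::
    "('a, 'm) ring_scheme \<Rightarrow> ('a \<Rightarrow> 'a) monoid \<Rightarrow> 'a set \<Rightarrow> (('a \<Rightarrow> 'a) \<times> ('a \<Rightarrow> 'a) \<Rightarrow> 'a) \<Rightarrow> ('a \<Rightarrow> 'a) set"
  where "inertial_group L G S b =
    {\<sigma> \<in> carrier G. b (\<sigma>, inv\<^bsub>G\<^esub> \<sigma>) \<in> Units (L\<lparr>carrier := S\<rparr>)}"

text \<open>The element \<open>\<Sum>\<sigma>. c \<sigma> x\<^sub>\<sigma>\<close> is represented by its coefficient function \<open>c\<close>.  The product is
  the biadditive extension of \<open>(s x\<^sub>\<sigma>) (t x\<^sub>\<tau>) = s \<sigma>(t) b(\<sigma>,\<tau>) x\<^sub>\<sigma>\<^sub>\<tau>\<close>, and the identity is \<open>x\<^sub>1\<close>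
  because \<open>b(1,\<sigma>) = b(\<sigma>,1) = 1\<close>.\<close>

definition weak_crossed_product ::
    "('a, 'm) ring_scheme \<Rightarrow> ('a \<Rightarrow> 'a) monoid \<Rightarrow> 'a set \<Rightarrow> (('a \<Rightarrow> 'a) \<times> ('a \<Rightarrow> 'a) \<Rightarrow> 'a) \<Rightarrow>
     (('a \<Rightarrow> 'a) \<Rightarrow> 'a) ring"
  where "weak_crossed_product L G S b =
    \<lparr>carrier = carrier G \<rightarrow>\<^sub>E S,
     monoid.mult = (\<lambda>c d. \<lambda>\<rho>\<in>carrier G.
       finsum L (\<lambda>(\<sigma>, \<tau>). c \<sigma> \<otimes>\<^bsub>L\<^esub> \<sigma> (d \<tau>) \<otimes>\<^bsub>L\<^esub> b (\<sigma>, \<tau>))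
         {(\<sigma>, \<tau>) \<in> carrier G \<times> carrier G. \<sigma> \<otimes>\<^bsub>G\<^esub> \<tau> = \<rho>}),
     one = (\<lambda>\<sigma>\<in>carrier G. if \<sigma> = \<one>\<^bsub>G\<^esub> then \<one>\<^bsub>L\<^esub> else \<zero>\<^bsub>L\<^esub>),
     ring.zero = (\<lambda>\<sigma>\<in>carrier G. \<zero>\<^bsub>L\<^esub>),
     ring.add = (\<lambda>c d. \<lambda>\<sigma>\<in>carrier G. c \<sigma> \<oplus>\<^bsub>L\<^esub> d \<sigma>)\<rparr>"


section \<open>Projective modules and hereditary rings\<close>

text \<open>The library's \<^locale>\<open>module\<close> requires a commutative ring of scalars.  As there, the
  multiplicative fields of the record \<open>M\<close> play no role.\<close>

locale left_module = R?: ring R + M?: abelian_group M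
  for R :: "('a, 'm) ring_scheme" (structure) and M :: "('a, 'b, 'n) module_scheme" (structure) +
  assumes smult_closed:
      "\<lbrakk>r \<in> carrier R; x \<in> carrier M\<rbrakk> \<Longrightarrow> r \<odot>\<^bsub>M\<^esub> x \<in> carrier M"
    and smult_l_distr:
      "\<lbrakk>r \<in> carrier R; s \<in> carrier R; x \<in> carrier M\<rbrakk> \<Longrightarrow>
       (r \<oplus> s) \<odot>\<^bsub>M\<^esub> x = r \<odot>\<^bsub>M\<^esub> x \<oplus>\<^bsub>M\<^esub> s \<odot>\<^bsub>M\<^esub> x"
    and smult_r_distr:
      "\<lbrakk>r \<in> carrier R; x \<in> carrier M; y \<in> carrier M\<rbrakk> \<Longrightarrow>
       r \<odot>\<^bsub>M\<^esub> (x \<oplus>\<^bsub>M\<^esub> y) = r \<odot>\<^bsub>M\<^esub> x \<oplus>\<^bsub>M\<^esub> r \<odot>\<^bsub>M\<^esub> y"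
    and smult_assoc:
      "\<lbrakk>r \<in> carrier R; s \<in> carrier R; x \<in> carrier M\<rbrakk> \<Longrightarrow> (r \<otimes> s) \<odot>\<^bsub>M\<^esub> x = r \<odot>\<^bsub>M\<^esub> (s \<odot>\<^bsub>M\<^esub> x)"
    and smult_one:
      "x \<in> carrier M \<Longrightarrow> \<one> \<odot>\<^bsub>M\<^esub> x = x"

definition left_module_hom ::
    "('a, 'm) ring_scheme \<Rightarrow> ('a, 'b, 'n) module_scheme \<Rightarrow> ('a, 'c, 'k) module_scheme \<Rightarrow> ('b \<Rightarrow> 'c) set"
  where "left_module_hom R M N =
    {f \<in> carrier M \<rightarrow> carrier N.
      (\<forall>x\<in>carrier M. \<forall>y\<in>carrier M. f (x \<oplus>\<^bsub>M\<^esub> y) = f x \<oplus>\<^bsub>N\<^esub> f y) \<and>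
      (\<forall>r\<in>carrier R. \<forall>x\<in>carrier M. f (r \<odot>\<^bsub>M\<^esub> x) = r \<odot>\<^bsub>N\<^esub> f x)}"

text \<open>Projectivity is the lifting property against surjections \<open>f : M \<rightarrow> N\<close>.  A definition cannot
  quantify over all types, but elements of type \<open>'b \<Rightarrow> 'a\<close> for \<open>M\<close> and \<open>'b\<close> for \<open>N\<close> suffice: they
  include the canonical surjection onto \<open>P\<close> from the free module on the set \<open>P\<close>, realised as the
  finitely supported functions from \<open>P\<close> to \<open>R\<close>.  Once it splits, \<open>P\<close> is a direct summand of a free
  module and so lifts against every surjection.\<close>

definition projective_left_module :: "('a, 'm) ring_scheme \<Rightarrow> ('a, 'b) module \<Rightarrow> bool"
  where "projective_left_module R P \<longleftrightarrow> left_module R P \<and>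
    (\<forall>(M :: ('a, 'b \<Rightarrow> 'a) module) (N :: ('a, 'b) module) f g.
       left_module R M \<longrightarrow> left_module R N \<longrightarrow>
       f \<in> left_module_hom R M N \<longrightarrow> f ` carrier M = carrier N \<longrightarrow>
       g \<in> left_module_hom R P N \<longrightarrow>
       (\<exists>h \<in> left_module_hom R P M. \<forall>x\<in>carrier P. f (h x) = g x))"

definition left_ideal :: "('a, 'm) ring_scheme \<Rightarrow> 'a set \<Rightarrow> bool"
  where "left_ideal R I \<longleftrightarrow>
    additive_subgroup I R \<and> (\<forall>r\<in>carrier R. \<forall>x\<in>I. r \<otimes>\<^bsub>R\<^esub> x \<in> I)"

definition left_ideal_module :: "('a, 'm) ring_scheme \<Rightarrow> 'a set \<Rightarrow> ('a, 'a) module"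
  where "left_ideal_module R I =
    \<lparr>carrier = I, monoid.mult = monoid.mult R, one = \<one>\<^bsub>R\<^esub>, ring.zero = \<zero>\<^bsub>R\<^esub>, ring.add = ring.add R, smult = monoid.mult R\<rparr>"

text \<open>Hereditary means left hereditary.  For orders over a discrete valuation ring this is
  equivalent to right hereditary.\<close>

definition hereditary :: "('a, 'm) ring_scheme \<Rightarrow> bool"
  where "hereditary R \<longleftrightarrow>
    (\<forall>I. left_ideal R I \<longrightarrow> projective_left_module R (left_ideal_module R I))"

end

theory Submission
  imports Defs
begin

text \<open>Put \<open>y\<^sub>\<sigma> = (1 / a \<sigma>) x\<^sub>\<sigma>\<close>, so that \<open>y\<^sub>\<sigma> y\<^sub>\<tau> = y\<^sub>\<sigma>\<^sub>\<tau>\<close>, and let \<open>\<Gamma>\<close> be the skew group ring spanned by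
  the \<open>y\<^sub>\<sigma>\<close> over \<open>S\<close>; it contains \<open>\<Lambda>\<close>, and \<open>t \<Gamma>\<close> is a left ideal of \<open>\<Lambda>\<close> for a suitable nonzero
  \<open>t \<in> S\<close> fixed by \<open>G\<close>.  A homomorphism from \<open>\<Gamma>\<close> to \<open>\<Lambda>\<close> is right multiplication by some \<open>q\<close> with
  \<open>\<Gamma> q \<subseteq> \<Lambda>\<close>.  Since \<open>H(b) \<noteq> G\<close>, some \<open>a(\<rho>)\<close> lies in the maximal ideal \<open>\<pi> S\<close>; looking at the
  coefficient of \<open>y\<^sub>\<tau> q\<close> at \<open>y\<^sub>\<rho>\<close> for all \<open>\<tau>\<close> shows that all coefficients of \<open>q\<close> with respect to the
  \<open>y\<^sub>\<sigma>\<close> lie in \<open>\<pi> S\<close>.  If \<open>t \<Gamma>\<close> were projective, the dual basis lemma would give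
  \<open>1 = \<Sum> q\<^sub>\<sigma> y\<^sub>\<sigma>\<close> with such \<open>q\<^sub>\<sigma>\<close>, hence \<open>1 \<in> \<pi> S\<close>.\<close>


section \<open>Projective left ideals\<close>

text \<open>\<open>E\<close> will be a finite generating set, so all functions on \<open>E\<close>
  form the free module; extensionality makes equality mean equality on \<open>E\<close>. When
  \<open>E\<close> consists of ring elements, the type is the one over which
  \<open>projective_left_module\<close> quantifies for \<open>M\<close>.\<close>

definition free_left_module :: "('a, 'm) ring_scheme \<Rightarrow> 'e set \<Rightarrow> ('a, 'e \<Rightarrow> 'a) module"
  where "free_left_module R E =
    \<lparr>carrier = E \<rightarrow>\<^sub>E carrier R, monoid.mult = undefined, one = undefined,
     ring.zero = (\<lambda>e\<in>E. \<zero>\<^bsub>R\<^esub>), ring.add = (\<lambda>m n. \<lambda>e\<in>E. m e \<oplus>\<^bsub>R\<^esub> n e),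
     smult = (\<lambda>r m. \<lambda>e\<in>E. r \<otimes>\<^bsub>R\<^esub> m e)\<rparr>"

lemma free_left_module_simps [simp]:
  "carrier (free_left_module R E) = (E \<rightarrow>\<^sub>E carrier R)"
  "m \<oplus>\<^bsub>free_left_module R E\<^esub> n = (\<lambda>e\<in>E. m e \<oplus>\<^bsub>R\<^esub> n e)"
  "\<zero>\<^bsub>free_left_module R E\<^esub> = (\<lambda>e\<in>E. \<zero>\<^bsub>R\<^esub>)"
  "r \<odot>\<^bsub>free_left_module R E\<^esub> m = (\<lambda>e\<in>E. r \<otimes>\<^bsub>R\<^esub> m e)"
  by (simp_all add: free_left_module_def)

lemma left_module_free:
  assumes "ring R" shows "left_module R (free_left_module R E)"
proof -
  interpret R: ring R by fact
  have "abelian_group (free_left_module R E)"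
  proof (rule abelian_groupI)
    fix m assume m: "m \<in> carrier (free_left_module R E)"
    show "\<exists>n\<in>carrier (free_left_module R E).
        n \<oplus>\<^bsub>free_left_module R E\<^esub> m = \<zero>\<^bsub>free_left_module R E\<^esub>"
      using m by (intro bexI[of _ "\<lambda>e\<in>E. \<ominus>\<^bsub>R\<^esub> m e"]) (auto intro!: restrict_ext R.l_neg)
    show "\<zero>\<^bsub>free_left_module R E\<^esub> \<oplus>\<^bsub>free_left_module R E\<^esub> m = m"
      using m by (auto simp: PiE_iff extensional_def)
  qed (auto intro!: restrict_ext R.a_assoc R.a_comm)
  then show ?thesis
    using assms
    by (auto simp: left_module_def left_module_axioms_def PiE_mem R.l_distr R.r_distr R.m_assoc
          PiE_iff extensional_def fun_eq_iff)
qed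

text \<open>Dual basis lemma: the generators give a surjection from the free module on
  \<open>E\<close> onto \<open>I\<close>, and the identity of \<open>I\<close> lifts along it. The
  coordinates of this splitting are the linear functionals \<open>\<lambda>x. h x e\<close>.\<close>

lemma projective_left_ideal_dual_basis:
  assumes proj: "projective_left_module R (left_ideal_module R I)"
    and I: "left_ideal R I" and E: "finite E" "E \<subseteq> I"
    and gen: "\<And>x. x \<in> I \<Longrightarrow> \<exists>m \<in> E \<rightarrow> carrier R. x = (\<Oplus>\<^bsub>R\<^esub>e\<in>E. m e \<otimes>\<^bsub>R\<^esub> e)"
  obtains h where "\<And>x e. x \<in> I \<Longrightarrow> e \<in> E \<Longrightarrow> h x e \<in> carrier R"
    and "\<And>r x e. r \<in> carrier R \<Longrightarrow> x \<in> I \<Longrightarrow> e \<in> E \<Longrightarrow> h (r \<otimes>\<^bsub>R\<^esub> x) e = r \<otimes>\<^bsub>R\<^esub> h x e"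
    and "\<And>x. x \<in> I \<Longrightarrow> x = (\<Oplus>\<^bsub>R\<^esub>e\<in>E. h x e \<otimes>\<^bsub>R\<^esub> e)"
proof -
  let ?P = "left_ideal_module R I" and ?M = "free_left_module R E"
  define f where "f = (\<lambda>m. \<Oplus>\<^bsub>R\<^esub>e\<in>E. m e \<otimes>\<^bsub>R\<^esub> e)"
  have P: "left_module R ?P"
    using proj by (simp add: projective_left_module_def)
  interpret R: ring R
    using P by (simp add: left_module_def)
  interpret I: additive_subgroup I R
    using I by (simp add: left_ideal_def)
  have IR: "x \<in> carrier R" if "x \<in> I" for x
    using that I.a_subset by blast
  have ER: "e \<in> carrier R" if "e \<in> E" for e
    using that E IR by blast
  have P_simps [simp]: "carrier ?P = I" "x \<oplus>\<^bsub>?P\<^esub> y = x \<oplus>\<^bsub>R\<^esub> y" "r \<odot>\<^bsub>?P\<^esub> x = r \<otimes>\<^bsub>R\<^esub> x" for r x y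
    by (simp_all add: left_ideal_module_def)
  \<comment> \<open>Partial sums over \<open>F \<subseteq> E\<close> are included to make the
    induction on \<open>F\<close> go through.\<close>
  have sum_I: "(\<Oplus>\<^bsub>R\<^esub>e\<in>F. m e \<otimes>\<^bsub>R\<^esub> e) \<in> I" if "m \<in> E \<rightarrow> carrier R" "F \<subseteq> E" for m F
    using finite_subset[OF that(2) E(1)] that
  proof (induction F rule: finite_induct)
    case (insert e F)
    have "m e \<otimes>\<^bsub>R\<^esub> e \<in> I"
      using insert.prems I E(2) by (auto simp: left_ideal_def Pi_iff subset_iff)
    then show ?case
      using insert ER by (subst R.finsum_insert) (auto intro!: I.a_closed R.m_closed simp: Pi_def subset_iff)
  qed simp
  have "f \<in> left_module_hom R ?M ?P"
    unfolding left_module_hom_def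
  proof (intro CollectI conjI ballI)
    show "f \<in> carrier ?M \<rightarrow> carrier ?P"
      using sum_I by (auto simp: f_def)
  next
    fix m n assume "m \<in> carrier ?M" "n \<in> carrier ?M"
    then have mn: "m e \<in> carrier R" "n e \<in> carrier R" if "e \<in> E" for e
      using that by auto
    have "f (m \<oplus>\<^bsub>?M\<^esub> n) = (\<Oplus>\<^bsub>R\<^esub>e\<in>E. m e \<otimes>\<^bsub>R\<^esub> e \<oplus>\<^bsub>R\<^esub> n e \<otimes>\<^bsub>R\<^esub> e)"
      unfolding f_def using mn ER by (intro R.finsum_cong') (auto simp: R.l_distr)
    also have "\<dots> = f m \<oplus>\<^bsub>?P\<^esub> f n"
      unfolding f_def using mn ER by (simp add: R.finsum_addf Pi_def)
    finally show "f (m \<oplus>\<^bsub>?M\<^esub> n) = f m \<oplus>\<^bsub>?P\<^esub> f n" .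
  next
    fix r m assume r: "r \<in> carrier R" and "m \<in> carrier ?M"
    then have m: "m e \<in> carrier R" if "e \<in> E" for e
      using that by auto
    have "f (r \<odot>\<^bsub>?M\<^esub> m) = (\<Oplus>\<^bsub>R\<^esub>e\<in>E. r \<otimes>\<^bsub>R\<^esub> (m e \<otimes>\<^bsub>R\<^esub> e))"
      unfolding f_def using m r ER by (intro R.finsum_cong') (auto simp: R.m_assoc)
    also have "\<dots> = r \<odot>\<^bsub>?P\<^esub> f m"
      unfolding f_def using m r ER E by (simp add: R.finsum_rdistr Pi_def)
    finally show "f (r \<odot>\<^bsub>?M\<^esub> m) = r \<odot>\<^bsub>?P\<^esub> f m" .
  qed
  moreover have "f ` carrier ?M = carrier ?P"
  proof (intro equalityI subsetI)
    fix x assume "x \<in> carrier ?P"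
    then obtain m where m: "m \<in> E \<rightarrow> carrier R" "x = f m"
      using gen[of x] by (auto simp: f_def)
    then have "x = f (restrict m E)"
      using ER by (auto simp: f_def Pi_def intro!: R.finsum_cong')
    then show "x \<in> f ` carrier ?M"
      using m(1) by auto
  qed (use sum_I in \<open>auto simp: f_def\<close>)
  moreover have "(\<lambda>x. x) \<in> left_module_hom R ?P ?P"
    by (auto simp: left_module_hom_def)
  moreover have "left_module R ?M"
    by (rule left_module_free) (fact R.ring_axioms)
  ultimately obtain h where h: "h \<in> left_module_hom R ?P ?M" "\<forall>x\<in>carrier ?P. f (h x) = x"
    using proj P unfolding projective_left_module_def by blast
  show ?thesis
  proof
    show "h x e \<in> carrier R" if "x \<in> I" "e \<in> E" for x e
      using h(1) that by (auto simp: left_module_hom_def Pi_iff PiE_iff)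
    show "h (r \<otimes>\<^bsub>R\<^esub> x) e = r \<otimes>\<^bsub>R\<^esub> h x e" if "r \<in> carrier R" "x \<in> I" "e \<in> E" for r x e
      using h(1) that by (auto simp: left_module_hom_def)
    show "x = (\<Oplus>\<^bsub>R\<^esub>e\<in>E. h x e \<otimes>\<^bsub>R\<^esub> e)" if "x \<in> I" for x
      using h(2) that by (simp add: f_def)
  qed
qed


section \<open>Integral closure of a discrete valuation ring\<close>

text \<open>An irreducible divisor of a nonzero nonunit generates a maximal ideal, which can only be
  \<open>M\<close>; a nonunit would therefore lie in \<open>M\<close>.\<close>

lemma (in principal_domain) maximalideal_is_local:
  assumes M: "\<And>J. maximalideal J R \<Longrightarrow> J = M" and M': "maximalideal M R"
    and x: "x \<in> carrier R" "x \<notin> M"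
  shows "x \<in> Units R"
proof (rule ccontr)
  assume nonunit: "x \<notin> Units R"
  interpret M: maximalideal M R by fact
  have "x \<noteq> \<zero>"
    using x(2) M.zero_closed by auto
  then obtain p where p: "p \<in> carrier R" "ring_irreducible p" "p divides x"
    using exists_irreducible_divisor[of x] x(1) nonunit by blast
  have "PIdl p = M"
    using M irreducible_imp_maximalideal p(1,2) by blast
  moreover obtain q where "q \<in> carrier R" "x = p \<otimes> q"
    using p(3) by (auto simp: factor_def)
  ultimately have "x \<in> M"
    using p(1) cgenideal_self[of p] M.I_r_closed[of p q] by simp
  with x(2) show False ..
qed

text \<open>The ideal generated by \<open>M\<close> and \<open>u\<close> is strictly larger than
  \<open>M\<close>, hence contains 1.\<close>

lemma (in cring) maximalideal_inverse_mod:
  assumes "maximalideal M R" "u \<in> carrier R" "u \<notin> M"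
  obtains s m where "s \<in> carrier R" "m \<in> M" "m \<oplus> s \<otimes> u = \<one>"
proof -
  interpret M: maximalideal M R by fact
  let ?J = "M <+>\<^bsub>R\<^esub> PIdl u"
  have J: "ideal ?J R"
    using assms(2) by (intro add_ideals M.is_ideal cgenideal_ideal)
  have "\<zero> \<oplus> u \<in> ?J"
    using assms(2) M.zero_closed cgenideal_self[of u] unfolding set_add_def' by blast
  then have u: "u \<in> ?J"
    using assms(2) by simp
  have "x \<oplus> \<zero> \<in> ?J" if "x \<in> M" for x
    using that additive_subgroup.zero_closed[OF ideal.axioms(1)[OF cgenideal_ideal[OF assms(2)]]]
    unfolding set_add_def' by blast
  then have "x \<in> ?J" if "x \<in> M" for x
    using that M.a_subset by (metis r_zero subsetD)
  moreover have "?J \<subseteq> carrier R"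
    using J by (meson additive_subgroup.a_subset ideal.axioms(1))
  ultimately have "?J = carrier R"
    using M.I_maximal[OF J] u assms(3) by auto
  then have "\<one> \<in> ?J"
    by simp
  then show ?thesis
    using that by (force simp: set_add_def' cgenideal_def)
qed

lemma (in domain) subring_subset_integral_closure:
  assumes "subring A R" shows "A \<subseteq> integral_closure R A"
proof
  fix x assume x: "x \<in> A"
  have A: "A \<subseteq> carrier R"
    using subringE(1)[OF assms] .
  have "[\<one>, \<ominus> x] \<in> carrier (A[X])"
    using x subringE[OF assms] by (auto simp: univ_poly_carrier[symmetric] polynomial_def)
  moreover have "eval [\<one>, \<ominus> x] x = \<zero>"
    using x A by (auto simp: r_neg)
  ultimately show "x \<in> integral_closure R A"
    unfolding integral_closure_def using x A by force
qed

text \<open>Since \<open>h\<close> fixes the coefficients of a monic equation over \<open>A\<close>,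
  it carries roots to roots. This makes the Galois group act on \<open>S\<close>.\<close>

lemma (in ring) integral_closure_hom_closed:
  assumes h: "h \<in> ring_hom R R" "\<And>x. x \<in> A \<Longrightarrow> h x = x" and A: "subring A R"
    and x: "x \<in> integral_closure R A"
  shows "h x \<in> integral_closure R A"
proof -
  interpret h: ring_hom_ring R R h
    by (intro ring_hom_ringI2 ring_axioms h)
  obtain p where p: "p \<in> carrier (A[X])" "p \<noteq> []" "hd p = \<one>" "eval p x = \<zero>" "x \<in> carrier R"
    using x by (auto simp: integral_closure_def)
  have "set p \<subseteq> A"
    using p(1,2) by (auto simp: univ_poly_carrier[symmetric] polynomial_def)
  then have "map h p = p"
    using h(2) by (intro map_idI) auto
  then have "eval p (h x) = \<zero>"
    using h.eval_hom[OF A p(5,1)] p(4) by simp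
  then show ?thesis
    using p by (auto simp: integral_closure_def)
qed

section \<open>Monic equations modulo 1 - c s\<close>

context cring
begin

text \<open>This is \<open>y [^] n = 1\<close> modulo \<open>1 - y\<close>, with the cofactor kept
  in \<open>T\<close> so that the divisibility takes place in the subring. It is applied to
  \<open>y = c s\<close>.\<close>

lemma one_minus_dvd_power:
  fixes n :: nat
  assumes T: "subring T R" and y: "y \<in> T"
  shows "\<exists>w\<in>T. y [^] n = \<one> \<oplus> (\<one> \<ominus> y) \<otimes> w"
proof (induction n)
  case 0
  show ?case
    using subringE(1,2)[OF T] y by (intro bexI[of _ \<zero>]) (auto simp: subset_iff a_minus_def)
next
  case (Suc n)
  then obtain w where w: "w \<in> T" "y [^] n = \<one> \<oplus> (\<one> \<ominus> y) \<otimes> w"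
    by auto
  have carr: "y \<in> carrier R" "w \<in> carrier R"
    using y w subringE(1)[OF T] by auto
  have "y [^] Suc n = (\<one> \<oplus> (\<one> \<ominus> y) \<otimes> w) \<otimes> y"
    using w by simp
  also have "\<dots> = \<one> \<oplus> (\<one> \<ominus> y) \<otimes> (w \<otimes> y \<ominus> \<one>)"
    using carr by algebra
  finally show ?case
    using y w(1)
    by (intro bexI[of _ "w \<otimes> y \<ominus> \<one>"]) (auto simp: a_minus_def intro!: subringE(3,5,6,7)[OF T])
qed

text \<open>The ring identity behind the induction step of \<open>eval_scaled\<close>. There
  \<open>d\<close> is \<open>1 - c s\<close>; keeping it abstract leaves a polynomial identity in
  independent variables.\<close>

lemma scaled_eval_step:
  assumes "c \<in> carrier R" "w \<in> carrier R" "d \<in> carrier R" "k \<in> carrier R" "v \<in> carrier R"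
    "x \<in> carrier R"
  shows "c \<otimes> x \<otimes> (\<one> \<oplus> d \<otimes> w) \<oplus> c \<otimes> (c \<otimes> k \<oplus> d \<otimes> v) =
    c \<otimes> (x \<oplus> c \<otimes> k) \<oplus> d \<otimes> (c \<otimes> x \<otimes> w \<oplus> c \<otimes> v)"
  using assms by algebra

text \<open>Multiplying by \<open>c ^ length p\<close> turns \<open>eval p s\<close> into a polynomial in \<open>c s\<close>, and \<open>c s = 1\<close> modulo
  \<open>1 - c s\<close>; every coefficient picks up at least one factor \<open>c\<close>.\<close>

lemma eval_scaled:
  assumes A: "subring A R" and T: "subring T R" "A \<subseteq> T" and s: "s \<in> T" and c: "c \<in> A"
    and p: "set p \<subseteq> A"
  shows "\<exists>k\<in>A. \<exists>v\<in>T. c [^] length p \<otimes> eval p s = c \<otimes> k \<oplus> (\<one> \<ominus> c \<otimes> s) \<otimes> v"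
  using p
proof (induction p)
  case Nil
  show ?case
    using subringE(1)[OF A] subringE(1)[OF T(1)] c s
    by (intro bexI[of _ \<zero>] subringE(2) A T(1)) (auto simp: a_minus_def subset_iff)
next
  case (Cons x p)
  note Tc = subringE[OF T(1)] and Ac = subringE[OF A]
  obtain k v where kv: "k \<in> A" "v \<in> T"
    "c [^] length p \<otimes> eval p s = c \<otimes> k \<oplus> (\<one> \<ominus> c \<otimes> s) \<otimes> v"
    using Cons by auto
  let ?n = "length p"
  obtain w where w: "w \<in> T" "(c \<otimes> s) [^] ?n = \<one> \<oplus> (\<one> \<ominus> c \<otimes> s) \<otimes> w"
    using one_minus_dvd_power[OF T(1), of "c \<otimes> s" ?n] Tc(6) c s T(2) by auto
  have x: "x \<in> A"
    using Cons.prems by auto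
  have set_p: "set p \<subseteq> carrier R"
    using Cons.prems Ac(1) by auto
  have carr [simp]: "c \<in> carrier R" "s \<in> carrier R" "w \<in> carrier R" "x \<in> carrier R" "k \<in> carrier R"
    "v \<in> carrier R" "eval p s \<in> carrier R"
    using c s w x kv Ac(1) Tc(1) set_p by (auto intro!: eval_in_carrier)
  have 1: "c [^] ?n \<otimes> s [^] ?n = \<one> \<oplus> (\<one> \<ominus> c \<otimes> s) \<otimes> w"
    using w by (simp add: nat_pow_distrib)
  have "c [^] length (x # p) \<otimes> eval (x # p) s
      = c \<otimes> x \<otimes> (c [^] ?n \<otimes> s [^] ?n) \<oplus> c \<otimes> (c [^] ?n \<otimes> eval p s)"
    using set_p by (simp add: r_distr m_ac)
  also have "\<dots> = c \<otimes> x \<otimes> (\<one> \<oplus> (\<one> \<ominus> c \<otimes> s) \<otimes> w) \<oplus> c \<otimes> (c \<otimes> k \<oplus> (\<one> \<ominus> c \<otimes> s) \<otimes> v)"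
    by (simp only: 1 kv(3))
  also have "\<dots> = c \<otimes> (x \<oplus> c \<otimes> k) \<oplus> (\<one> \<ominus> c \<otimes> s) \<otimes> (c \<otimes> x \<otimes> w \<oplus> c \<otimes> v)"
    by (intro scaled_eval_step) (simp_all add: carr)
  finally have "c [^] length (x # p) \<otimes> eval (x # p) s =
      c \<otimes> (x \<oplus> c \<otimes> k) \<oplus> (\<one> \<ominus> c \<otimes> s) \<otimes> (c \<otimes> x \<otimes> w \<oplus> c \<otimes> v)" .
  moreover have "x \<oplus> c \<otimes> k \<in> A" "c \<otimes> x \<otimes> w \<oplus> c \<otimes> v \<in> T"
    using c w(1) x kv(1,2) T(2) by (auto intro!: Tc(6,7) Ac(6,7))
  ultimately show ?case
    by blast
qed

text \<open>\<open>c [^] length q\<close> times the monic equation of \<open>s\<close> reads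
  \<open>0 = 1 + c k\<close> modulo \<open>1 - c s\<close>, and \<open>1 + c k\<close> is a unit of \<open>A\<close>.\<close>

lemma integral_closure_inverse_mod:
  assumes A: "subring A R" and T: "subring T R" "A \<subseteq> T" and c: "c \<in> A"
    and unit: "\<And>k. k \<in> A \<Longrightarrow> \<exists>z\<in>A. (\<one> \<oplus> c \<otimes> k) \<otimes> z = \<one>"
    and s: "s \<in> integral_closure R A" "s \<in> T"
  shows "\<exists>z\<in>T. (\<one> \<ominus> c \<otimes> s) \<otimes> z = \<one>"
proof -
  note Tc = subringE[OF T(1)] and Ac = subringE[OF A]
  obtain p where p: "p \<in> carrier (A[X])" "p \<noteq> []" "hd p = \<one>" "eval p s = \<zero>"
    using s by (auto simp: integral_closure_def)
  obtain q where q: "p = \<one> # q"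
    using p(2,3) by (cases p) auto
  have set_q: "set q \<subseteq> A"
    using p(1) by (auto simp: q univ_poly_carrier[symmetric] polynomial_def)
  let ?n = "length q" and ?d = "\<one> \<ominus> c \<otimes> s"
  obtain k v where kv: "k \<in> A" "v \<in> T" "c [^] ?n \<otimes> eval q s = c \<otimes> k \<oplus> ?d \<otimes> v"
    using eval_scaled[OF A T s(2) c set_q] by auto
  obtain w where w: "w \<in> T" "(c \<otimes> s) [^] ?n = \<one> \<oplus> ?d \<otimes> w"
    using one_minus_dvd_power[OF T(1), of "c \<otimes> s" ?n] Tc(6) c s(2) T(2) by auto
  obtain z where z: "z \<in> A" "(\<one> \<oplus> c \<otimes> k) \<otimes> z = \<one>"
    using unit[OF kv(1)] by auto
  have carr: "c \<in> carrier R" "s \<in> carrier R" "w \<in> carrier R" "k \<in> carrier R"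
    "v \<in> carrier R" "z \<in> carrier R" "eval q s \<in> carrier R" "?d \<in> carrier R"
    using c s w z kv Ac(1) Tc(1) set_q by (auto intro!: eval_in_carrier)
  have "\<zero> = c [^] ?n \<otimes> (s [^] ?n \<oplus> eval q s)"
    using p(4) carr by (simp add: q)
  also have "\<dots> = (c \<otimes> s) [^] ?n \<oplus> c [^] ?n \<otimes> eval q s"
    using carr by (simp add: r_distr nat_pow_distrib)
  also have "\<dots> = (\<one> \<oplus> ?d \<otimes> w) \<oplus> (c \<otimes> k \<oplus> ?d \<otimes> v)"
    by (simp only: w kv(3))
  also have "\<dots> = (\<one> \<oplus> c \<otimes> k) \<oplus> ?d \<otimes> (w \<oplus> v)"
    using carr by (simp add: r_distr a_ac)
  finally have "?d \<otimes> (w \<oplus> v) = \<ominus> (\<one> \<oplus> c \<otimes> k)"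
    using carr by (metis a_closed a_comm m_closed minus_equality one_closed)
  \<comment> \<open>\<open>?d\<close> divides the negative of the unit
    \<open>\<one> \<oplus> c \<otimes> k\<close>, whose inverse is \<open>z\<close>; this gives the
    inverse of \<open>?d\<close> explicitly.\<close>
  then have "?d \<otimes> (\<ominus> (w \<oplus> v) \<otimes> z) = \<one>"
    using carr z(2) by (metis a_closed a_inv_closed l_minus m_assoc m_closed minus_minus one_closed r_minus)
  moreover have "\<ominus> (w \<oplus> v) \<otimes> z \<in> T"
    using w(1) kv(2) z(1) T(2) by (intro Tc(5,6,7)) auto
  ultimately show ?thesis ..
qed

end


text \<open>\<open>S\<close> is local with maximal ideal \<open>P\<close>. If \<open>c\<close>
  generates the maximal ideal of \<open>R\<close>, then \<open>P\<close> consists of multiples of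
  \<open>c\<close>, so inverting \<open>u\<close> modulo \<open>P\<close> gives
  \<open>s u = 1 - c s'\<close> with \<open>s'\<close> in \<open>S\<close>. The right side is a unit
  of \<open>S\<close>, because \<open>s'\<close> is integral over \<open>R\<close> and every
  \<open>1 + c k\<close> with \<open>k\<close> in \<open>R\<close> is a unit of
  \<open>R\<close>.\<close>

lemma unramified_integral_closure:
  assumes L: "field L" and R: "subring R L" "discrete_valuation_ring (L\<lparr>carrier := R\<rparr>)"
    and S: "S = integral_closure L R" and unram: "unramified_finite_residue L R S"
    and P: "P = genideal (L\<lparr>carrier := S\<rparr>) (max_ideal (L\<lparr>carrier := R\<rparr>))"
  shows "subring S L" "maximalideal P (L\<lparr>carrier := S\<rparr>)"
    and "u \<in> S \<Longrightarrow> u \<notin> P \<Longrightarrow> u \<in> Units (L\<lparr>carrier := S\<rparr>)"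
    and "max_ideal (L\<lparr>carrier := R\<rparr>) \<subseteq> R" "R \<subseteq> S"
proof -
  interpret L: field L by fact
  let ?R = "L\<lparr>carrier := R\<rparr>" and ?S = "L\<lparr>carrier := S\<rparr>"
  let ?M = "max_ideal ?R"
  interpret R: principal_domain ?R
    using R(2) by (simp add: discrete_valuation_ring_def)
  have "\<exists>!M. maximalideal M ?R"
    using R(2) by (simp add: discrete_valuation_ring_def)
  then have M: "maximalideal ?M ?R" "\<And>J. maximalideal J ?R \<Longrightarrow> J = ?M"
    unfolding max_ideal_def by (metis theI')+
  interpret M: maximalideal ?M ?R by (fact M(1))
  show PM: "maximalideal P ?S"
    using unram by (simp add: P unramified_finite_residue_def)
  have S_L: "S \<subseteq> carrier L"
    by (auto simp: S integral_closure_def)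
  \<comment> \<open>Closure of \<open>S\<close> under the ring operations is read off from
    \<open>PM\<close>: the locale \<open>maximalideal\<close> includes that its ambient structure is
    a ring.\<close>
  show S_sub: "subring S L"
    by (rule L.ring_incl_imp_subring[OF S_L ideal.axioms(2)[OF maximalideal.axioms(1)[OF PM]]])
  interpret S: cring ?S
    using L.subring_is_domain[OF S_sub] by (simp add: domain_def)
  interpret P: maximalideal P ?S by (fact PM)
  show M_R: "?M \<subseteq> R"
    using M.a_subset by simp
  show R_S: "R \<subseteq> S"
    unfolding S by (rule L.subring_subset_integral_closure) fact
  obtain c where c: "c \<in> R" "?M = PIdl\<^bsub>?R\<^esub> c"
    using R.exists_gen[OF M.is_ideal] by auto
  \<comment> \<open>The multiples of \<open>c\<close> in \<open>S\<close> form an ideal of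
    \<open>S\<close> containing \<open>?M\<close>, and \<open>P\<close> is the smallest such
    ideal.\<close>
  have "P \<subseteq> PIdl\<^bsub>?S\<^esub> c"
    unfolding P using c R_S
    by (intro S.genideal_minimal S.cgenideal_ideal) (auto simp: cgenideal_def)
  then have P_c: "\<exists>s\<in>S. m = c \<otimes>\<^bsub>L\<^esub> s" if "m \<in> P" for m
  proof -
    obtain s where "s \<in> S" "m = s \<otimes>\<^bsub>L\<^esub> c"
      using \<open>P \<subseteq> PIdl\<^bsub>?S\<^esub> c\<close> \<open>m \<in> P\<close> by (auto simp: cgenideal_def)
    then show ?thesis
      using c(1) R_S S_L L.m_comm[of s c] by auto
  qed
  \<comment> \<open>Modulo \<open>?M\<close> the element \<open>1 + c k\<close> equals 1, so it lies
    outside the only maximal ideal of \<open>R\<close>.\<close>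
  have unit: "\<exists>z\<in>R. (\<one>\<^bsub>L\<^esub> \<oplus>\<^bsub>L\<^esub> c \<otimes>\<^bsub>L\<^esub> k) \<otimes>\<^bsub>L\<^esub> z = \<one>\<^bsub>L\<^esub>" if k: "k \<in> R" for k
  proof -
    have ck: "c \<otimes>\<^bsub>L\<^esub> k \<in> ?M"
      using c k R.cgenideal_self[of c] M.I_r_closed[of c k] by simp
    let ?x = "\<one>\<^bsub>L\<^esub> \<oplus>\<^bsub>L\<^esub> c \<otimes>\<^bsub>L\<^esub> k"
    have x: "?x \<in> R"
      using c k subringE[OF R(1)] by auto
    have "?x \<notin> ?M"
    proof
      assume "?x \<in> ?M"
      then have "?x \<oplus>\<^bsub>?R\<^esub> (\<ominus>\<^bsub>?R\<^esub> (c \<otimes>\<^bsub>?R\<^esub> k)) \<in> ?M"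
        using ck by (intro M.a_closed M.a_inv_closed) auto
      moreover have "?x \<oplus>\<^bsub>?R\<^esub> (\<ominus>\<^bsub>?R\<^esub> (c \<otimes>\<^bsub>?R\<^esub> k)) = \<one>\<^bsub>?R\<^esub>"
        using R.a_assoc[of "\<one>\<^bsub>?R\<^esub>" "c \<otimes>\<^bsub>?R\<^esub> k" "\<ominus>\<^bsub>?R\<^esub> (c \<otimes>\<^bsub>?R\<^esub> k)"] R.r_neg[of "c \<otimes>\<^bsub>?R\<^esub> k"]
          R.r_zero[of "\<one>\<^bsub>?R\<^esub>"] R.m_closed[of c k] R.one_closed R.a_inv_closed[of "c \<otimes>\<^bsub>?R\<^esub> k"] c k
        by simp
      ultimately show False
        using M.one_imp_carrier M.I_notcarr by simp
    qed
    then have "?x \<in> Units ?R"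
      using R.maximalideal_is_local[OF M(2,1)] x by simp
    then show ?thesis
      by (auto simp: Units_def)
  qed
  show "u \<in> Units ?S" if u: "u \<in> S" "u \<notin> P"
  proof -
    obtain s m where sm: "s \<in> S" "m \<in> P" "m \<oplus>\<^bsub>L\<^esub> s \<otimes>\<^bsub>L\<^esub> u = \<one>\<^bsub>L\<^esub>"
      using S.maximalideal_inverse_mod[OF PM, of u] u by auto
    obtain s' where s': "s' \<in> S" "m = c \<otimes>\<^bsub>L\<^esub> s'"
      using P_c sm(2) by auto
    obtain z where z: "z \<in> S" "(\<one>\<^bsub>L\<^esub> \<ominus>\<^bsub>L\<^esub> c \<otimes>\<^bsub>L\<^esub> s') \<otimes>\<^bsub>L\<^esub> z = \<one>\<^bsub>L\<^esub>"
      using L.integral_closure_inverse_mod[OF R(1) S_sub R_S c(1) unit, of s'] s' S by auto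
    have carr: "s \<in> carrier L" "m \<in> carrier L" "u \<in> carrier L" "z \<in> carrier L"
      using sm s' z u S_L P.a_subset by auto
    have "s \<otimes>\<^bsub>L\<^esub> u = \<one>\<^bsub>L\<^esub> \<ominus>\<^bsub>L\<^esub> m"
      using L.r_neg1[of m "s \<otimes>\<^bsub>L\<^esub> u"] carr by (simp add: sm(3) L.minus_eq L.a_comm)
    then have "(s \<otimes>\<^bsub>L\<^esub> z) \<otimes>\<^bsub>L\<^esub> u = \<one>\<^bsub>L\<^esub>"
      using z(2) s'(2) carr by (metis L.m_assoc L.m_comm L.m_closed)
    moreover have "s \<otimes>\<^bsub>L\<^esub> z \<in> S"
      using sm z subringE(6)[OF S_sub] by auto
    ultimately show ?thesis
      using u carr L.m_comm[of "s \<otimes>\<^bsub>L\<^esub> z" u] by (auto simp: Units_def)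
  qed
qed

text \<open>The preimage under \<open>h\<close> of the generated ideal is again an ideal containing
  \<open>M\<close>. This makes the Galois group preserve \<open>P\<close>, which is generated by
  elements of \<open>R\<close>.\<close>

lemma genideal_hom_closed:
  assumes S: "cring S" and h: "h \<in> ring_hom S S" and M: "M \<subseteq> carrier S" "\<And>x. x \<in> M \<Longrightarrow> h x = x"
    and x: "x \<in> genideal S M"
  shows "h x \<in> genideal S M"
proof -
  interpret S: cring S by fact
  interpret h: ring_hom_ring S S h
    by (intro ring_hom_ringI2 S.ring_axioms h)
  let ?I = "genideal S M"
  let ?J = "{x \<in> carrier S. h x \<in> ?I}"
  have "ideal ?J S"
    by (rule h.ideal_vimage[OF S.genideal_ideal[OF M(1)]])
  moreover have "M \<subseteq> ?J"
    using M S.genideal_self[OF M(1)] by auto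
  ultimately have "?I \<subseteq> ?J"
    by (rule S.genideal_minimal)
  then show ?thesis
    using x by auto
qed


section \<open>Galois groups\<close>

lemma galois_group_mem:
  assumes "\<sigma> \<in> carrier (galois_group L K)"
  shows "\<sigma> \<in> Bij (carrier L)" "\<sigma> \<in> ring_hom L L" "\<sigma> \<in> extensional (carrier L)"
    "\<And>x. x \<in> K \<Longrightarrow> \<sigma> x = x"
  using assms by (auto simp: galois_group_def ring_iso_def Bij_def)

lemma galois_group_mult:
  assumes "\<sigma> \<in> carrier (galois_group L K)" "\<tau> \<in> carrier (galois_group L K)" "x \<in> carrier L"
  shows "(\<sigma> \<otimes>\<^bsub>galois_group L K\<^esub> \<tau>) x = \<sigma> (\<tau> x)"
  using galois_group_mem(1)[OF assms(1)] galois_group_mem(1)[OF assms(2)] assms(3)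
  by (simp add: galois_group_def BijGroup_def compose_def)

lemma galois_group_one:
  "x \<in> carrier L \<Longrightarrow> \<one>\<^bsub>galois_group L K\<^esub> x = x"
  by (simp add: galois_group_def BijGroup_def)

lemma group_galois_group:
  assumes "field L" "subfield K L"
  shows "group (galois_group L K)"
proof -
  interpret L: field L by fact
  interpret B: group "BijGroup (carrier L)" by (rule group_BijGroup)
  let ?H = "carrier (galois_group L K)"
  have K: "K \<subseteq> carrier L"
    by (rule subfieldE(3)[OF assms(2)])
  have "subgroup ?H (BijGroup (carrier L))"
  proof (rule B.subgroupI)
    show "?H \<subseteq> carrier (BijGroup (carrier L))"
      using galois_group_mem(1) by (auto simp: BijGroup_def)
    have "(\<lambda>x\<in>carrier L. x) \<in> ?H"
      using K by (auto simp: galois_group_def ring_iso_def ring_hom_def bij_betw_def inj_on_def)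
    then show "?H \<noteq> {}"
      by blast
  next
    fix \<sigma> assume s: "\<sigma> \<in> ?H"
    note \<sigma> = galois_group_mem[OF s]
    let ?i = "\<lambda>x\<in>carrier L. inv_into (carrier L) \<sigma> x"
    have bij: "bij_betw \<sigma> (carrier L) (carrier L)"
      using \<sigma>(1) by (simp add: Bij_def)
    have bij': "bij_betw ?i (carrier L) (carrier L)"
      using restrict_inv_into_Bij[OF \<sigma>(1)] by (simp add: Bij_def)
    \<comment> \<open>With this rule each homomorphism law for the inverse map is reduced to the
      same law for \<open>\<sigma>\<close>.\<close>
    have inv: "?i y = x" if "x \<in> carrier L" "\<sigma> x = y" for x y
      using that bij by (auto simp: bij_betw_def)
    have cl: "?i y \<in> carrier L" "\<sigma> (?i y) = y" if "y \<in> carrier L" for y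
      using that bij by (auto simp: bij_betw_def f_inv_into_f inv_into_into)
    have "?i \<in> ring_iso L L"
      unfolding ring_iso_def ring_hom_def
      using bij' cl ring_hom_mult[OF \<sigma>(2)] ring_hom_add[OF \<sigma>(2)] ring_hom_one[OF \<sigma>(2)]
      by (auto simp del: restrict_apply intro!: inv)
    then have "?i \<in> ?H"
      using K \<sigma>(4) by (auto simp: galois_group_def simp del: restrict_apply intro!: inv)
    then show "inv\<^bsub>BijGroup (carrier L)\<^esub> \<sigma> \<in> ?H"
      using inv_BijGroup[OF \<sigma>(1)] by simp
  next
    fix \<sigma> \<tau> assume st: "\<sigma> \<in> ?H" "\<tau> \<in> ?H"
    note \<sigma> = galois_group_mem[OF st(1)] and \<tau> = galois_group_mem[OF st(2)]
    have "compose (carrier L) \<sigma> \<tau> \<in> ring_iso L L"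
      using \<sigma> \<tau> ring_hom_closed[OF \<tau>(2)] compose_Bij[OF \<sigma>(1) \<tau>(1)]
      by (auto simp: ring_iso_def ring_hom_def compose_def Bij_def)
    then show "\<sigma> \<otimes>\<^bsub>BijGroup (carrier L)\<^esub> \<tau> \<in> ?H"
      using \<sigma> \<tau> K by (auto simp: BijGroup_def galois_group_def compose_def)
  qed
  then have "group ((BijGroup (carrier L))\<lparr>carrier := ?H\<rparr>)"
    by (rule B.subgroup_imp_group)
  then show ?thesis
    by (simp add: galois_group_def)
qed

text \<open>An automorphism over \<open>K\<close> is determined by its values on a finite spanning
  list \<open>Us\<close>, and its value at \<open>u\<close> is a root of a fixed nonzero polynomial
  over \<open>K\<close> that vanishes at \<open>u\<close>. Restriction to \<open>Us\<close> thus
  embeds the group in a finite product of root sets.\<close>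

lemma finite_galois_group:
  assumes "field L" "subfield K L" "ring.finite_dimension L K (carrier L)"
  shows "finite (carrier (galois_group L K))"
proof -
  interpret L: field L by fact
  let ?H = "carrier (galois_group L K)"
  have K: "subring K L" "K \<subseteq> carrier L"
    using subfieldE(1,3)[OF assms(2)] by auto
  obtain Us where Us: "set Us \<subseteq> carrier L" "L.Span K Us = carrier L"
    using L.exists_base[OF assms(2) L.finite_dimensionE[OF assms(2,3)]] by blast
  have "\<exists>p. p \<in> carrier (K [X]\<^bsub>L\<^esub>) \<and> p \<noteq> [] \<and> L.eval p u = \<zero>\<^bsub>L\<^esub>" if "u \<in> set Us" for u
    using that Us(1) L.finite_dimension_imp_algebraic[OF assms(2) L.carrier_is_subring assms(3)]
      L.algebraicE[OF K(1)] by (metis subsetD over_def)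
  then obtain p where p: "p u \<in> carrier (K [X]\<^bsub>L\<^esub>)" "p u \<noteq> []" "L.eval (p u) u = \<zero>\<^bsub>L\<^esub>"
    if "u \<in> set Us" for u
    by metis
  have eval: "L.is_root (p u) (\<sigma> u)" if u: "u \<in> set Us" and s: "\<sigma> \<in> ?H" for u \<sigma>
  proof -
    note \<sigma> = galois_group_mem[OF s]
    interpret \<sigma>: ring_hom_ring L L \<sigma>
      by (intro ring_hom_ringI2 L.ring_axioms \<sigma>(2))
    have "set (p u) \<subseteq> K"
      using p(1)[OF u] by (auto simp: univ_poly_carrier[symmetric] polynomial_def)
    then have "map \<sigma> (p u) = p u"
      using \<sigma>(4) by (intro map_idI) auto
    then show ?thesis
      using \<sigma>.eval_hom[OF K(1) _ p(1)[OF u], of u] p(2,3)[OF u] u Us(1) \<sigma>.hom_closed[of u]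
      by (auto simp: L.is_root_def)
  qed
  let ?Z = "\<lambda>u. {x. L.is_root (p u) x}"
  have "finite (Pi\<^sub>E (set Us) ?Z)"
    using p(1) L.carrier_polynomial_shell[OF K(1)]
    by (intro finite_PiE L.finite_number_of_roots) auto
  moreover have "(\<lambda>\<sigma>. restrict \<sigma> (set Us)) ` ?H \<subseteq> Pi\<^sub>E (set Us) ?Z"
    using eval by auto
  moreover have "inj_on (\<lambda>\<sigma>. restrict \<sigma> (set Us)) ?H"
  proof (rule inj_onI)
    fix \<sigma> \<tau> assume st: "\<sigma> \<in> ?H" "\<tau> \<in> ?H" and eq: "restrict \<sigma> (set Us) = restrict \<tau> (set Us)"
    note \<sigma> = galois_group_mem[OF st(1)] and \<tau> = galois_group_mem[OF st(2)]
    interpret \<sigma>: ring_hom_ring L L \<sigma>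
      by (intro ring_hom_ringI2 L.ring_axioms \<sigma>(2))
    interpret \<tau>: ring_hom_ring L L \<tau>
      by (intro ring_hom_ringI2 L.ring_axioms \<tau>(2))
    have eq': "\<sigma> u = \<tau> u" if "u \<in> set Us" for u
      using eq that by (metis restrict_apply')
    \<comment> \<open>Stated for arbitrary lists \<open>Vs\<close> of spanning elements, because the
      recursion of \<open>combine\<close> passes to tails.\<close>
    have comb: "\<sigma> (L.combine Ks Vs) = \<tau> (L.combine Ks Vs)"
      if "set Ks \<subseteq> K" "set Vs \<subseteq> set Us" for Ks Vs
      using that
    proof (induction Ks Vs rule: L.combine.induct)
      case (1 k Ks v Vs)
      have "L.combine Ks Vs \<in> carrier L" "k \<in> carrier L" "v \<in> carrier L"
        using 1 K(2) Us(1) by (auto intro!: L.combine_in_carrier)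
      then show ?case
        using 1 \<sigma>(4)[of k] \<tau>(4)[of k] by (simp add: eq')
    qed simp_all
    have "\<sigma> x = \<tau> x" if "x \<in> carrier L" for x
    proof -
      have "x \<in> L.Span K Us"
        using that Us(2) by simp
      then obtain Ks where "set Ks \<subseteq> K" "x = L.combine Ks Us"
        using L.Span_eq_combine_set[OF assms(2) Us(1)] by auto
      then show ?thesis
        using comb by simp
    qed
    then show "\<sigma> = \<tau>"
      using \<sigma>(3) \<tau>(3) by (intro extensionalityI) auto
  qed
  ultimately show ?thesis
    by (meson finite_subset finite_imageD)
qed


section \<open>Orders associated to coboundaries\<close>

text \<open>The setting distilled to a finite group acting on the field \<open>L\<close> that
  preserves the subring \<open>S\<close> and a proper ideal \<open>P\<close>. The coboundary
  relation is multiplied out, which avoids inverses in \<open>L\<close>; \<open>\<rho>0\<close> is a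
  place where \<open>a\<close> takes a value in \<open>P\<close>.\<close>

locale coboundary_order = L?: field L + G: group G
  for L :: "('a, 'm) ring_scheme" (structure) and G :: "('a \<Rightarrow> 'a) monoid" +
  fixes S P :: "'a set" and a :: "('a \<Rightarrow> 'a) \<Rightarrow> 'a"
    and b :: "('a \<Rightarrow> 'a) \<times> ('a \<Rightarrow> 'a) \<Rightarrow> 'a" and \<rho>0 :: "'a \<Rightarrow> 'a"
  assumes finite_G: "finite (carrier G)"
    and hom: "\<And>\<phi>. \<phi> \<in> carrier G \<Longrightarrow> \<phi> \<in> ring_hom L L"
    and act_mult: "\<And>\<phi> \<tau> x. \<phi> \<in> carrier G \<Longrightarrow> \<tau> \<in> carrier G \<Longrightarrow> x \<in> carrier L \<Longrightarrow>
      (\<phi> \<otimes>\<^bsub>G\<^esub> \<tau>) x = \<phi> (\<tau> x)"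
    and act_one: "\<And>x. x \<in> carrier L \<Longrightarrow> \<one>\<^bsub>G\<^esub> x = x"
    and S: "subring S L"
    and act_S: "\<And>\<phi> x. \<phi> \<in> carrier G \<Longrightarrow> x \<in> S \<Longrightarrow> \<phi> x \<in> S"
    and P: "ideal P (L\<lparr>carrier := S\<rparr>)" "\<one> \<notin> P"
    and act_P: "\<And>\<phi> x. \<phi> \<in> carrier G \<Longrightarrow> x \<in> P \<Longrightarrow> \<phi> x \<in> P"
    and a: "\<And>\<phi>. \<phi> \<in> carrier G \<Longrightarrow> a \<phi> \<in> S" "\<And>\<phi>. \<phi> \<in> carrier G \<Longrightarrow> a \<phi> \<noteq> \<zero>" "a \<one>\<^bsub>G\<^esub> = \<one>"
    and b: "\<And>\<phi> \<tau>. \<phi> \<in> carrier G \<Longrightarrow> \<tau> \<in> carrier G \<Longrightarrow> b (\<phi>, \<tau>) \<in> S"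
      "\<And>\<phi> \<tau>. \<phi> \<in> carrier G \<Longrightarrow> \<tau> \<in> carrier G \<Longrightarrow>
        b (\<phi>, \<tau>) \<otimes> a (\<phi> \<otimes>\<^bsub>G\<^esub> \<tau>) = a \<phi> \<otimes> \<phi> (a \<tau>)"
    and \<rho>0: "\<rho>0 \<in> carrier G" "a \<rho>0 \<in> P"
begin

abbreviation \<Lambda> where "\<Lambda> \<equiv> weak_crossed_product L G S b"

section \<open>The action on S and P, and an invariant common multiple\<close>

lemma S_carrier: "x \<in> S \<Longrightarrow> x \<in> carrier L"
  using subringE(1)[OF S] by blast

lemmas S_closed = subringE(2,3,5,6,7)[OF S]

lemma P_S: "x \<in> P \<Longrightarrow> x \<in> S"
  using additive_subgroup.a_subset[OF ideal.axioms(1)[OF P(1)]] by auto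

lemma P_add: "x \<in> P \<Longrightarrow> y \<in> P \<Longrightarrow> x \<oplus> y \<in> P"
  using additive_subgroup.a_closed[OF ideal.axioms(1)[OF P(1)]] by simp

lemma P_zero: "\<zero> \<in> P"
  using additive_subgroup.zero_closed[OF ideal.axioms(1)[OF P(1)]] by simp

lemma P_mult: "x \<in> P \<Longrightarrow> y \<in> S \<Longrightarrow> x \<otimes> y \<in> P"
  using ideal.I_r_closed[OF P(1)] by simp

lemma act_carrier: "\<phi> \<in> carrier G \<Longrightarrow> x \<in> carrier L \<Longrightarrow> \<phi> x \<in> carrier L"
  using ring_hom_closed[OF hom] by blast

lemmas act_times = ring_hom_mult[OF hom]

lemma act_nonzero: "\<phi> \<in> carrier G \<Longrightarrow> x \<in> carrier L \<Longrightarrow> x \<noteq> \<zero> \<Longrightarrow> \<phi> x \<noteq> \<zero>"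
proof
  assume s: "\<phi> \<in> carrier G" and x: "x \<in> carrier L" "x \<noteq> \<zero>" and "\<phi> x = \<zero>"
  have "x = (inv\<^bsub>G\<^esub> \<phi> \<otimes>\<^bsub>G\<^esub> \<phi>) x"
    using s x by (simp add: act_one)
  also have "\<dots> = (inv\<^bsub>G\<^esub> \<phi>) \<zero>"
    using s x \<open>\<phi> x = \<zero>\<close> act_mult[of "inv\<^bsub>G\<^esub> \<phi>" \<phi> x] by (simp del: G.l_inv)
  also have "\<dots> = \<zero>"
    using ring_hom_zero[OF hom[of "inv\<^bsub>G\<^esub> \<phi>"] L.ring_axioms L.ring_axioms] s by simp
  finally show False
    using x by simp
qed

lemma a_carrier: "\<phi> \<in> carrier G \<Longrightarrow> a \<phi> \<in> carrier L"
  using a(1) S_carrier by blast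

lemma b_one_left: "\<tau> \<in> carrier G \<Longrightarrow> b (\<one>\<^bsub>G\<^esub>, \<tau>) = \<one>"
  using b(2)[of "\<one>\<^bsub>G\<^esub>" \<tau>] b(1)[of "\<one>\<^bsub>G\<^esub>" \<tau>] a(2)[of \<tau>] a(3) a_carrier[of \<tau>] S_carrier
  by (simp add: act_one) (metis L.l_one L.m_rcancel L.one_closed)

text \<open>Take \<open>t\<close> to be the norm of the product \<open>?A\<close> of all
  \<open>a \<phi>\<close>. The group permutes the factors of a norm, and the factor of the norm at
  the identity is \<open>?A\<close> itself, which every \<open>a \<phi>\<close> divides.\<close>

lemma exists_invariant_multiple:
  "\<exists>t\<in>S. t \<noteq> \<zero> \<and> (\<forall>\<phi>\<in>carrier G. \<phi> t = t) \<and> (\<forall>\<phi>\<in>carrier G. \<exists>u\<in>S. t = u \<otimes> a \<phi>)"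
proof -
  let ?N = "\<lambda>x. \<Otimes>\<^bsub>L\<^esub>\<tau>\<in>carrier G. \<tau> x"
  let ?A = "\<Otimes>\<^bsub>L\<^esub>\<phi>\<in>carrier G. a \<phi>"
  have prod_S: "finprod L f F \<in> S" if "finite F" "f \<in> F \<rightarrow> S" for f and F :: "('a \<Rightarrow> 'a) set"
    using that by (induction F rule: finite_induct)
      (auto simp: Pi_def S_carrier L.finprod_insert intro!: S_closed)
  have prod_nz: "finprod L f F \<noteq> \<zero>" if "finite F" "f \<in> F \<rightarrow> carrier L - {\<zero>}"
    for f and F :: "('a \<Rightarrow> 'a) set"
    using that by (induction F rule: finite_induct)
      (auto simp: Pi_def L.finprod_insert L.integral_iff)
  have dvd: "\<exists>u\<in>S. finprod L f (carrier G) = u \<otimes> f \<phi>"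
    if "f \<in> carrier G \<rightarrow> S" "\<phi> \<in> carrier G" for f \<phi>
  proof -
    have "finprod L f (insert \<phi> (carrier G - {\<phi>})) = f \<phi> \<otimes> finprod L f (carrier G - {\<phi>})"
      using that finite_G S_carrier by (intro L.finprod_insert) (auto simp: Pi_def)
    moreover have "finprod L f (carrier G - {\<phi>}) \<in> S"
      using that finite_G by (intro prod_S) auto
    moreover have "f \<phi> \<in> carrier L"
      using that S_carrier by auto
    ultimately show ?thesis
      using that S_carrier by (auto simp: insert_absorb L.m_comm[of "f \<phi>"])
  qed
  have AS: "?A \<in> S"
    using prod_S finite_G a by auto
  have A0: "?A \<noteq> \<zero>"
    using prod_nz finite_G a S_carrier by auto
  have NS: "?N ?A \<in> S"
    using prod_S finite_G AS act_S by auto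
  show ?thesis
  proof (rule bexI[of _ "?N ?A"], intro conjI ballI)
    show "?N ?A \<in> S" by (fact NS)
    show "?N ?A \<noteq> \<zero>"
      using prod_nz[OF finite_G] act_nonzero S_carrier[OF AS] A0 act_carrier by (auto simp: Pi_def)
    show "\<exists>u\<in>S. ?N ?A = u \<otimes> a \<phi>" if \<phi>: "\<phi> \<in> carrier G" for \<phi>
    proof -
      obtain u where u: "u \<in> S" "?N ?A = u \<otimes> \<one>\<^bsub>G\<^esub> ?A"
        using dvd[of "\<lambda>\<tau>. \<tau> ?A" "\<one>\<^bsub>G\<^esub>"] act_S AS by auto
      obtain v where v: "v \<in> S" "?A = v \<otimes> a \<phi>"
        using dvd[of a \<phi>] a(1) \<phi> by auto
      have "?N ?A = u \<otimes> v \<otimes> a \<phi>"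
        using u v \<phi> S_carrier AS a_carrier by (simp add: act_one L.m_assoc)
      then show ?thesis
        using u v S_closed by blast
    qed
    show "\<phi> (?N ?A) = ?N ?A" if \<phi>: "\<phi> \<in> carrier G" for \<phi>
    proof -
      interpret \<phi>: ring_hom_cring L L \<phi>
        by (intro ring_hom_cringI ring_hom_ring.intro ring_hom_ring_axioms.intro L.is_cring
            L.ring_axioms hom \<phi>)
      have "\<phi> (?N ?A) = (\<Otimes>\<^bsub>L\<^esub>\<tau>\<in>carrier G. \<phi> (\<tau> ?A))"
        using act_carrier S_carrier[OF AS] by (subst \<phi>.hom_finprod) (auto simp: comp_def)
      also have "\<dots> = (\<Otimes>\<^bsub>L\<^esub>\<tau>\<in>carrier G. (\<phi> \<otimes>\<^bsub>G\<^esub> \<tau>) ?A)"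
        using act_carrier S_carrier[OF AS] \<phi> by (intro L.finprod_cong') (auto simp: act_mult)
      \<comment> \<open>Left translation by \<open>\<phi>\<close> is a bijection of
        \<open>G\<close>, so it only reorders the factors.\<close>
      also have "\<dots> = (\<Otimes>\<^bsub>L\<^esub>\<tau>\<in>(\<lambda>\<tau>. \<phi> \<otimes>\<^bsub>G\<^esub> \<tau>) ` carrier G. \<tau> ?A)"
        using act_carrier S_carrier[OF AS] \<phi> G.inj_on_cmult[OF \<phi>]
        by (subst L.finprod_reindex) auto
      also have "(\<lambda>\<tau>. \<phi> \<otimes>\<^bsub>G\<^esub> \<tau>) ` carrier G = carrier G"
        using G.surj_const_mult[OF \<phi>] .
      finally show ?thesis .
    qed
  qed
qed

section \<open>Arithmetic in the weak crossed product order\<close>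

lemma \<Lambda>_simps:
  "carrier \<Lambda> = (carrier G \<rightarrow>\<^sub>E S)"
  "\<zero>\<^bsub>\<Lambda>\<^esub> = (\<lambda>\<phi>\<in>carrier G. \<zero>)"
  "c \<oplus>\<^bsub>\<Lambda>\<^esub> d = (\<lambda>\<phi>\<in>carrier G. c \<phi> \<oplus> d \<phi>)"
  by (simp_all add: weak_crossed_product_def)

lemma \<Lambda>_apply: "c \<in> carrier \<Lambda> \<Longrightarrow> \<phi> \<in> carrier G \<Longrightarrow> c \<phi> \<in> S"
  by (auto simp: \<Lambda>_simps)

lemma \<Lambda>_term:
  assumes "x \<in> S" "y \<in> S" "\<phi> \<in> carrier G" "\<tau> \<in> carrier G"
  shows "x \<otimes> \<phi> y \<otimes> b (\<phi>, \<tau>) \<in> S"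
  using assms by (intro S_closed(4) b(1) act_S[of \<phi>])

text \<open>The pairs with product \<open>\<rho>\<close> are parametrised by their first component,
  which turns the convolution into a sum over \<open>G\<close>.\<close>

lemma \<Lambda>_mult:
  assumes c: "c \<in> carrier \<Lambda>" and d: "d \<in> carrier \<Lambda>" and \<rho>: "\<rho> \<in> carrier G"
  shows "(c \<otimes>\<^bsub>\<Lambda>\<^esub> d) \<rho> = (\<Oplus>\<phi>\<in>carrier G. c \<phi> \<otimes> \<phi> (d (inv\<^bsub>G\<^esub> \<phi> \<otimes>\<^bsub>G\<^esub> \<rho>)) \<otimes> b (\<phi>, inv\<^bsub>G\<^esub> \<phi> \<otimes>\<^bsub>G\<^esub> \<rho>))"
proof -
  let ?g = "\<lambda>\<phi>. (\<phi>, inv\<^bsub>G\<^esub> \<phi> \<otimes>\<^bsub>G\<^esub> \<rho>)"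
  have set_eq: "{(\<phi>, \<tau>) \<in> carrier G \<times> carrier G. \<phi> \<otimes>\<^bsub>G\<^esub> \<tau> = \<rho>} = ?g ` carrier G"
    using \<rho> by (auto simp: image_iff G.m_assoc[symmetric])
  have "c \<phi> \<otimes> \<phi> (d \<tau>) \<otimes> b (\<phi>, \<tau>) \<in> carrier L" if "\<phi> \<in> carrier G" "\<tau> \<in> carrier G" for \<phi> \<tau>
    using \<Lambda>_term[OF \<Lambda>_apply[OF c] \<Lambda>_apply[OF d]] that S_carrier by blast
  then have "finsum L (\<lambda>(\<phi>, \<tau>). c \<phi> \<otimes> \<phi> (d \<tau>) \<otimes> b (\<phi>, \<tau>)) (?g ` carrier G) =
      (\<Oplus>\<phi>\<in>carrier G. c \<phi> \<otimes> \<phi> (d (inv\<^bsub>G\<^esub> \<phi> \<otimes>\<^bsub>G\<^esub> \<rho>)) \<otimes> b (\<phi>, inv\<^bsub>G\<^esub> \<phi> \<otimes>\<^bsub>G\<^esub> \<rho>))"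
    using \<rho> by (subst L.finsum_reindex) (auto simp: inj_on_def)
  then show ?thesis
    using \<rho> unfolding set_eq[symmetric] by (simp add: weak_crossed_product_def)
qed

lemma sum_S: "f \<in> carrier G \<rightarrow> S \<Longrightarrow> (\<Oplus>\<phi>\<in>carrier G. f \<phi>) \<in> S"
proof -
  have "finsum L f F \<in> S" if "finite F" "f \<in> F \<rightarrow> S" for f and F :: "('a \<Rightarrow> 'a) set"
    using that by (induction F rule: finite_induct)
      (auto simp: Pi_def S_carrier L.finsum_insert intro!: S_closed)
  then show "f \<in> carrier G \<rightarrow> S \<Longrightarrow> (\<Oplus>\<phi>\<in>carrier G. f \<phi>) \<in> S"
    using finite_G by blast
qed

lemma \<Lambda>_mult_closed:
  assumes c: "c \<in> carrier \<Lambda>" and d: "d \<in> carrier \<Lambda>"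
  shows "c \<otimes>\<^bsub>\<Lambda>\<^esub> d \<in> carrier \<Lambda>"
proof -
  have "(c \<otimes>\<^bsub>\<Lambda>\<^esub> d) \<rho> \<in> S" if "\<rho> \<in> carrier G" for \<rho>
    unfolding \<Lambda>_mult[OF c d that] using that
    by (intro sum_S Pi_I \<Lambda>_term[OF \<Lambda>_apply[OF c] \<Lambda>_apply[OF d]]) auto
  moreover have "c \<otimes>\<^bsub>\<Lambda>\<^esub> d \<in> extensional (carrier G)"
    by (simp add: weak_crossed_product_def)
  ultimately show ?thesis
    by (simp add: \<Lambda>_simps PiE_iff)
qed

lemma abelian_group_\<Lambda>: "abelian_group \<Lambda>"
proof (rule abelian_groupI)
  fix c assume c: "c \<in> carrier \<Lambda>"
  then show "\<exists>d\<in>carrier \<Lambda>. d \<oplus>\<^bsub>\<Lambda>\<^esub> c = \<zero>\<^bsub>\<Lambda>\<^esub>"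
    by (intro bexI[of _ "\<lambda>\<phi>\<in>carrier G. \<ominus> c \<phi>"])
      (auto simp: \<Lambda>_simps PiE_iff intro!: restrict_ext L.l_neg S_carrier S_closed)
  show "\<zero>\<^bsub>\<Lambda>\<^esub> \<oplus>\<^bsub>\<Lambda>\<^esub> c = c"
    using c by (auto simp: \<Lambda>_simps PiE_iff extensional_def fun_eq_iff S_carrier)
qed (auto simp: \<Lambda>_simps PiE_iff intro!: restrict_ext L.a_assoc L.a_comm S_carrier S_closed)

lemma \<Lambda>_finsum_apply:
  assumes "finite E" "f \<in> E \<rightarrow> carrier \<Lambda>" "\<rho> \<in> carrier G"
  shows "(\<Oplus>\<^bsub>\<Lambda>\<^esub>e\<in>E. f e) \<rho> = (\<Oplus>e\<in>E. f e \<rho>)"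
proof -
  interpret \<Lambda>: abelian_group \<Lambda> by (fact abelian_group_\<Lambda>)
  show ?thesis
    using assms
  proof (induction E rule: finite_induct)
    case empty
    then show ?case by (simp add: \<Lambda>_simps)
  next
    case (insert e E)
    have "f x \<rho> \<in> carrier L" if "x \<in> insert e E" for x
      using that insert.prems by (intro S_carrier \<Lambda>_apply[of "f x"]) (auto simp: Pi_iff)
    moreover have "f \<in> E \<rightarrow> carrier \<Lambda>" "f e \<in> carrier \<Lambda>"
      using insert.prems by auto
    ultimately show ?case
      using insert by (simp add: Pi_def) (simp add: \<Lambda>_simps)
  qed
qed

text \<open>This is the element \<open>s x\<^sub>\<phi>\<close>.\<close>

definition monom :: "'a \<Rightarrow> ('a \<Rightarrow> 'a) \<Rightarrow> ('a \<Rightarrow> 'a) \<Rightarrow> 'a"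
  where "monom s \<phi> = (\<lambda>\<tau>\<in>carrier G. if \<tau> = \<phi> then s else \<zero>)"

lemma monom_closed: "s \<in> S \<Longrightarrow> monom s \<phi> \<in> carrier \<Lambda>"
  using S_closed by (auto simp: monom_def \<Lambda>_simps)

lemma act_zero: "\<phi> \<in> carrier G \<Longrightarrow> \<phi> \<zero> = \<zero>"
  by (rule ring_hom_zero[OF hom L.ring_axioms L.ring_axioms])

lemma sum_single:
  assumes "\<phi> \<in> carrier G" "x \<in> carrier L" "\<And>\<tau>. \<tau> \<in> carrier G \<Longrightarrow> f \<tau> = (if \<tau> = \<phi> then x else \<zero>)"
  shows "(\<Oplus>\<tau>\<in>carrier G. f \<tau>) = x"
proof -
  have "(\<Oplus>\<tau>\<in>carrier G. f \<tau>) = (\<Oplus>\<tau>\<in>carrier G. if \<phi> = \<tau> then x else \<zero>)"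
    using assms by (intro L.finsum_cong') auto
  also have "\<dots> = x"
    using L.finsum_singleton[OF assms(1) finite_G, of "\<lambda>_. x"] assms(2) by simp
  finally show ?thesis .
qed

lemma monom_mult:
  assumes s: "s \<in> S" and \<phi>: "\<phi> \<in> carrier G" and d: "d \<in> carrier \<Lambda>" and \<rho>: "\<rho> \<in> carrier G"
  shows "(monom s \<phi> \<otimes>\<^bsub>\<Lambda>\<^esub> d) (\<phi> \<otimes>\<^bsub>G\<^esub> \<rho>) = s \<otimes> \<phi> (d \<rho>) \<otimes> b (\<phi>, \<rho>)"
proof -
  note d' = \<Lambda>_apply[OF d]
  have "(monom s \<phi> \<otimes>\<^bsub>\<Lambda>\<^esub> d) (\<phi> \<otimes>\<^bsub>G\<^esub> \<rho>) = (\<Oplus>\<tau>\<in>carrier G.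
      monom s \<phi> \<tau> \<otimes> \<tau> (d (inv\<^bsub>G\<^esub> \<tau> \<otimes>\<^bsub>G\<^esub> (\<phi> \<otimes>\<^bsub>G\<^esub> \<rho>))) \<otimes> b (\<tau>, inv\<^bsub>G\<^esub> \<tau> \<otimes>\<^bsub>G\<^esub> (\<phi> \<otimes>\<^bsub>G\<^esub> \<rho>)))"
    using s \<phi> d \<rho> by (intro \<Lambda>_mult monom_closed) auto
  also have "\<dots> = s \<otimes> \<phi> (d \<rho>) \<otimes> b (\<phi>, \<rho>)"
  proof (rule sum_single[OF \<phi>])
    show "s \<otimes> \<phi> (d \<rho>) \<otimes> b (\<phi>, \<rho>) \<in> carrier L"
      by (rule S_carrier) (rule \<Lambda>_term[OF s d'[OF \<rho>] \<phi> \<rho>])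
    fix \<tau> assume \<tau>: "\<tau> \<in> carrier G"
    let ?\<rho> = "inv\<^bsub>G\<^esub> \<tau> \<otimes>\<^bsub>G\<^esub> (\<phi> \<otimes>\<^bsub>G\<^esub> \<rho>)"
    have "\<tau> (d ?\<rho>) \<in> carrier L" "b (\<tau>, ?\<rho>) \<in> carrier L"
      using \<tau> \<phi> \<rho> d'[of ?\<rho>] b(1)[of \<tau> ?\<rho>] act_S[of \<tau> "d ?\<rho>"] by (auto intro: S_carrier)
    then show "monom s \<phi> \<tau> \<otimes> \<tau> (d ?\<rho>) \<otimes> b (\<tau>, ?\<rho>) =
        (if \<tau> = \<phi> then s \<otimes> \<phi> (d \<rho>) \<otimes> b (\<phi>, \<rho>) else \<zero>)"
      using \<tau> \<phi> \<rho> by (auto simp: monom_def G.inv_solve_left[symmetric] G.m_assoc[symmetric])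
  qed
  finally show ?thesis .
qed

lemma mult_monom:
  assumes s: "s \<in> S" and \<phi>: "\<phi> \<in> carrier G" and d: "d \<in> carrier \<Lambda>" and \<rho>: "\<rho> \<in> carrier G"
  shows "(d \<otimes>\<^bsub>\<Lambda>\<^esub> monom s \<phi>) (\<rho> \<otimes>\<^bsub>G\<^esub> \<phi>) = d \<rho> \<otimes> \<rho> s \<otimes> b (\<rho>, \<phi>)"
proof -
  note d' = \<Lambda>_apply[OF d]
  have "(d \<otimes>\<^bsub>\<Lambda>\<^esub> monom s \<phi>) (\<rho> \<otimes>\<^bsub>G\<^esub> \<phi>) = (\<Oplus>\<tau>\<in>carrier G.
      d \<tau> \<otimes> \<tau> (monom s \<phi> (inv\<^bsub>G\<^esub> \<tau> \<otimes>\<^bsub>G\<^esub> (\<rho> \<otimes>\<^bsub>G\<^esub> \<phi>))) \<otimes> b (\<tau>, inv\<^bsub>G\<^esub> \<tau> \<otimes>\<^bsub>G\<^esub> (\<rho> \<otimes>\<^bsub>G\<^esub> \<phi>)))"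
    using s \<phi> d \<rho> by (intro \<Lambda>_mult monom_closed) auto
  also have "\<dots> = d \<rho> \<otimes> \<rho> s \<otimes> b (\<rho>, \<phi>)"
  proof (rule sum_single[OF \<rho>])
    show "d \<rho> \<otimes> \<rho> s \<otimes> b (\<rho>, \<phi>) \<in> carrier L"
      by (rule S_carrier) (rule \<Lambda>_term[OF d'[OF \<rho>] s \<rho> \<phi>])
    fix \<tau> assume \<tau>: "\<tau> \<in> carrier G"
    let ?\<rho> = "inv\<^bsub>G\<^esub> \<tau> \<otimes>\<^bsub>G\<^esub> (\<rho> \<otimes>\<^bsub>G\<^esub> \<phi>)"
    \<comment> \<open>This isolates the single surviving summand, the one with
      \<open>\<tau> = \<rho>\<close>.\<close>
    have 1: "?\<rho> = \<phi> \<longleftrightarrow> \<tau> = \<rho>"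
      using \<tau> \<phi> \<rho> by (metis G.inv_solve_left G.m_closed G.r_cancel)
    have 2: "?\<rho> \<in> carrier G"
      using \<tau> \<phi> \<rho> by auto
    have "d \<tau> \<in> carrier L" "b (\<tau>, ?\<rho>) \<in> carrier L"
      using \<tau> 2 d' b(1) by (auto intro!: S_carrier)
    then show "d \<tau> \<otimes> \<tau> (monom s \<phi> ?\<rho>) \<otimes> b (\<tau>, ?\<rho>) =
        (if \<tau> = \<rho> then d \<rho> \<otimes> \<rho> s \<otimes> b (\<rho>, \<phi>) else \<zero>)"
      using \<tau> \<phi> 1 2 by (auto simp: monom_def act_zero)
  qed
  finally show ?thesis .
qed

lemma one_monom_mult:
  assumes s: "s \<in> S" and d: "d \<in> carrier \<Lambda>" and \<rho>: "\<rho> \<in> carrier G"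
  shows "(monom s \<one>\<^bsub>G\<^esub> \<otimes>\<^bsub>\<Lambda>\<^esub> d) \<rho> = s \<otimes> d \<rho>"
  using monom_mult[OF s G.one_closed d \<rho>] \<rho> s S_carrier[OF \<Lambda>_apply[OF d \<rho>]] S_carrier[OF s]
  by (simp add: act_one b_one_left)

lemma b_one_right:
  assumes "\<phi> \<in> carrier G" shows "b (\<phi>, \<one>\<^bsub>G\<^esub>) = \<one>"
proof -
  have "b (\<phi>, \<one>\<^bsub>G\<^esub>) \<otimes> a \<phi> = \<one> \<otimes> a \<phi>"
    using b(2)[OF assms G.one_closed] assms a(3) a_carrier[OF assms] ring_hom_one[OF hom[OF assms]]
    by simp
  then show ?thesis
    using a(2)[OF assms] a_carrier[OF assms] S_carrier[OF b(1)[OF assms G.one_closed]]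
    by (metis L.m_rcancel L.one_closed)
qed

lemma P_sum:
  assumes "f \<in> carrier G \<rightarrow> P" shows "(\<Oplus>\<phi>\<in>carrier G. f \<phi>) \<in> P"
proof -
  have "finsum L f F \<in> P" if "finite F" "f \<in> F \<rightarrow> P" for F :: "('a \<Rightarrow> 'a) set"
    using that
  proof (induction F rule: finite_induct)
    case (insert x F)
    then have "f \<in> F \<rightarrow> carrier L" "f x \<in> carrier L"
      using P_S S_carrier by blast+
    then show ?case
      using insert by (simp add: L.finsum_insert P_add)
  qed (simp add: P_zero)
  then show ?thesis
    using finite_G assms by blast
qed

section \<open>The left ideal spanned by the scaled group elements\<close>

text \<open>The elements \<open>y\<^sub>\<sigma> = (1 / a \<sigma>) x\<^sub>\<sigma>\<close> multiply like the group elements; the set below is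
  \<open>t\<close> times the skew group ring that they span over \<open>S\<close>.\<close>

definition scaled_group_ring :: "'a \<Rightarrow> (('a \<Rightarrow> 'a) \<Rightarrow> 'a) set"
  where "scaled_group_ring t =
    {c \<in> carrier \<Lambda>. \<forall>\<phi>\<in>carrier G. \<exists>s\<in>S. c \<phi> \<otimes> a \<phi> = t \<otimes> s}"

text \<open>As \<open>x\<^sub>\<phi> = a \<phi> y\<^sub>\<phi>\<close>, the coefficient of
  \<open>c\<close> at \<open>y\<^sub>\<phi>\<close> is \<open>c \<phi> \<otimes> a \<phi>\<close>,
  and the condition asks that \<open>t\<close> divide all of these in \<open>S\<close>. Left
  multiplication preserves it because \<open>y\<close>-coefficients multiply as in a skew group ring
  and the action fixes \<open>t\<close>.\<close>

lemma left_ideal_scaled_group_ring: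
  assumes t: "t \<in> S" "\<And>\<phi>. \<phi> \<in> carrier G \<Longrightarrow> \<phi> t = t"
  shows "left_ideal \<Lambda> (scaled_group_ring t)"
  unfolding left_ideal_def
proof (intro conjI ballI)
  let ?I = "scaled_group_ring t"
  interpret \<Lambda>: abelian_group \<Lambda> by (fact abelian_group_\<Lambda>)
  have tL: "t \<in> carrier L"
    using t S_carrier by auto
  have I_memI: "c \<in> ?I" if "c \<in> carrier \<Lambda>"
    "\<And>\<phi>. \<phi> \<in> carrier G \<Longrightarrow> \<exists>s\<in>S. c \<phi> \<otimes> a \<phi> = t \<otimes> s" for c
    using that by (auto simp: scaled_group_ring_def)
  have I_memD: "\<exists>s\<in>S. c \<phi> \<otimes> a \<phi> = t \<otimes> s" if "c \<in> ?I" "\<phi> \<in> carrier G" for c \<phi>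
    using that by (auto simp: scaled_group_ring_def)
  have I_\<Lambda>: "c \<in> carrier \<Lambda>" if "c \<in> ?I" for c
    using that by (auto simp: scaled_group_ring_def)
  have "subgroup ?I (add_monoid \<Lambda>)"
  proof
    show "?I \<subseteq> carrier (add_monoid \<Lambda>)"
      using I_\<Lambda> by auto
    show "\<one>\<^bsub>add_monoid \<Lambda>\<^esub> \<in> ?I"
      using \<Lambda>.zero_closed S_closed(1) a_carrier tL
      by (auto simp: \<Lambda>_simps intro!: I_memI bexI[of _ \<zero>])
  next
    fix c d assume cd: "c \<in> ?I" "d \<in> ?I"
    note c = I_\<Lambda>[OF cd(1)] and d = I_\<Lambda>[OF cd(2)]
    show "c \<otimes>\<^bsub>add_monoid \<Lambda>\<^esub> d \<in> ?I"
    proof (rule I_memI)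
      show "c \<otimes>\<^bsub>add_monoid \<Lambda>\<^esub> d \<in> carrier \<Lambda>"
        using c d by simp
      fix \<phi> assume \<phi>: "\<phi> \<in> carrier G"
      obtain s r where "s \<in> S" "c \<phi> \<otimes> a \<phi> = t \<otimes> s" "r \<in> S" "d \<phi> \<otimes> a \<phi> = t \<otimes> r"
        using I_memD[OF cd(1) \<phi>] I_memD[OF cd(2) \<phi>] by blast
      then show "\<exists>s\<in>S. (c \<otimes>\<^bsub>add_monoid \<Lambda>\<^esub> d) \<phi> \<otimes> a \<phi> = t \<otimes> s"
        using \<phi> S_carrier[OF \<Lambda>_apply[OF c \<phi>]] S_carrier[OF \<Lambda>_apply[OF d \<phi>]] a_carrier[OF \<phi>] tL
          S_carrier S_closed(5)
        by (intro bexI[of _ "s \<oplus> r"]) (simp_all add: \<Lambda>_simps L.l_distr L.r_distr)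
    qed
    \<comment> \<open>The abstract additive inverse is identified with the pointwise negative so
      that its coefficients can be computed.\<close>
    have inv: "inv\<^bsub>add_monoid \<Lambda>\<^esub> c = (\<lambda>\<phi>\<in>carrier G. \<ominus> c \<phi>)" (is "_ = ?n")
    proof -
      have "?n \<in> carrier \<Lambda>"
        using \<Lambda>_apply[OF c] S_closed(3) by (auto simp: \<Lambda>_simps)
      moreover have "?n \<oplus>\<^bsub>\<Lambda>\<^esub> c = \<zero>\<^bsub>\<Lambda>\<^esub>"
        using S_carrier[OF \<Lambda>_apply[OF c]] by (auto simp: \<Lambda>_simps L.l_neg intro!: restrict_ext)
      ultimately show ?thesis
        using \<Lambda>.minus_equality[of ?n c] c by (simp add: a_inv_def)
    qed
    show "inv\<^bsub>add_monoid \<Lambda>\<^esub> c \<in> ?I"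
    proof (rule I_memI)
      show "inv\<^bsub>add_monoid \<Lambda>\<^esub> c \<in> carrier \<Lambda>"
        using \<Lambda>.a_inv_closed[OF c] by (simp add: a_inv_def)
      fix \<phi> assume \<phi>: "\<phi> \<in> carrier G"
      obtain s where "s \<in> S" "c \<phi> \<otimes> a \<phi> = t \<otimes> s"
        using I_memD[OF cd(1) \<phi>] by blast
      then show "\<exists>s\<in>S. (inv\<^bsub>add_monoid \<Lambda>\<^esub> c) \<phi> \<otimes> a \<phi> = t \<otimes> s"
        using \<phi> S_carrier[OF \<Lambda>_apply[OF c \<phi>]] a_carrier[OF \<phi>] tL S_carrier S_closed(3)
        unfolding inv by (intro bexI[of _ "\<ominus> s"]) (simp_all add: L.l_minus L.r_minus)
    qed
  qed
  then show "additive_subgroup ?I \<Lambda>"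
    by (rule additive_subgroup.intro)
next
  fix r c assume r: "r \<in> carrier \<Lambda>" and cI: "c \<in> scaled_group_ring t"
  then have c: "c \<in> carrier \<Lambda>"
    by (simp add: scaled_group_ring_def)
  have tL: "t \<in> carrier L"
    using t S_carrier by auto
  have "\<forall>\<phi>\<in>carrier G. \<exists>s. s \<in> S \<and> c \<phi> \<otimes> a \<phi> = t \<otimes> s"
    using cI by (auto simp: scaled_group_ring_def)
  from bchoice[OF this] obtain s where
    s: "s \<phi> \<in> S" "c \<phi> \<otimes> a \<phi> = t \<otimes> s \<phi>" if "\<phi> \<in> carrier G" for \<phi>
    by auto
  have "\<exists>x\<in>S. (r \<otimes>\<^bsub>\<Lambda>\<^esub> c) \<rho> \<otimes> a \<rho> = t \<otimes> x" if \<rho>: "\<rho> \<in> carrier G" for \<rho>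
  proof -
    let ?q = "\<lambda>\<phi>. inv\<^bsub>G\<^esub> \<phi> \<otimes>\<^bsub>G\<^esub> \<rho>"
    \<comment> \<open>\<open>t \<otimes> ?y \<phi>\<close> is the contribution of index
      \<open>\<phi>\<close> to the coefficient of the product at \<open>y\<^sub>\<rho>\<close>. In
      \<open>step\<close> the coboundary relation replaces
      \<open>b (\<phi>, ?q \<phi>) \<otimes> a \<rho>\<close> by the factors needed to pass to
      \<open>y\<close>-coefficients.\<close>
    let ?y = "\<lambda>\<phi>. r \<phi> \<otimes> a \<phi> \<otimes> \<phi> (s (?q \<phi>))"
    have y_S: "?y \<phi> \<in> S" if \<phi>: "\<phi> \<in> carrier G" for \<phi>
      using \<Lambda>_apply[OF r \<phi>] a(1)[OF \<phi>] act_S[OF \<phi>, of "s (?q \<phi>)"] s(1)[of "?q \<phi>"] \<phi> \<rho> S_closed(4)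
      by auto
    have step: "r \<phi> \<otimes> \<phi> (c (?q \<phi>)) \<otimes> b (\<phi>, ?q \<phi>) \<otimes> a \<rho> = t \<otimes> ?y \<phi>" if \<phi>: "\<phi> \<in> carrier G" for \<phi>
    proof -
      have q: "?q \<phi> \<in> carrier G" "\<phi> \<otimes>\<^bsub>G\<^esub> ?q \<phi> = \<rho>"
        using \<phi> \<rho> by (auto simp: G.m_assoc[symmetric])
      have cL: "c (?q \<phi>) \<in> carrier L" "a (?q \<phi>) \<in> carrier L" "s (?q \<phi>) \<in> carrier L"
        "r \<phi> \<in> carrier L" "a \<phi> \<in> carrier L" "a \<rho> \<in> carrier L" "b (\<phi>, ?q \<phi>) \<in> carrier L"
        using \<Lambda>_apply[OF c q(1)] \<Lambda>_apply[OF r \<phi>] a(1) b(1) s(1) q \<phi> \<rho> S_carrier by auto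
      note acL = act_carrier[OF \<phi> cL(1)] act_carrier[OF \<phi> cL(2)] act_carrier[OF \<phi> cL(3)]
      have "r \<phi> \<otimes> \<phi> (c (?q \<phi>)) \<otimes> b (\<phi>, ?q \<phi>) \<otimes> a \<rho>
          = r \<phi> \<otimes> \<phi> (c (?q \<phi>)) \<otimes> (b (\<phi>, ?q \<phi>) \<otimes> a \<rho>)"
        using cL acL by (simp add: L.m_assoc)
      also have "b (\<phi>, ?q \<phi>) \<otimes> a \<rho> = a \<phi> \<otimes> \<phi> (a (?q \<phi>))"
        using b(2)[OF \<phi> q(1)] q(2) by simp
      also have "r \<phi> \<otimes> \<phi> (c (?q \<phi>)) \<otimes> (a \<phi> \<otimes> \<phi> (a (?q \<phi>)))
          = r \<phi> \<otimes> a \<phi> \<otimes> \<phi> (c (?q \<phi>) \<otimes> a (?q \<phi>))"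
        using cL acL by (simp add: act_times[OF \<phi>] L.m_ac)
      also have "\<dots> = r \<phi> \<otimes> a \<phi> \<otimes> (t \<otimes> \<phi> (s (?q \<phi>)))"
        using cL tL by (simp add: s(2)[OF q(1)] act_times[OF \<phi>] t(2)[OF \<phi>])
      also have "\<dots> = t \<otimes> ?y \<phi>"
        using cL acL tL by (simp add: L.m_ac)
      finally show ?thesis .
    qed
    have term_L: "r \<phi> \<otimes> \<phi> (c (?q \<phi>)) \<otimes> b (\<phi>, ?q \<phi>) \<in> carrier L" if \<phi>: "\<phi> \<in> carrier G" for \<phi>
    proof -
      have q: "?q \<phi> \<in> carrier G"
        using \<phi> \<rho> by simp
      show ?thesis
        by (rule S_carrier[OF \<Lambda>_term[OF \<Lambda>_apply[OF r \<phi>] \<Lambda>_apply[OF c q] \<phi> q]])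
    qed
    have "(r \<otimes>\<^bsub>\<Lambda>\<^esub> c) \<rho> \<otimes> a \<rho> = (\<Oplus>\<phi>\<in>carrier G. r \<phi> \<otimes> \<phi> (c (?q \<phi>)) \<otimes> b (\<phi>, ?q \<phi>) \<otimes> a \<rho>)"
      unfolding \<Lambda>_mult[OF r c \<rho>] using term_L finite_G a_carrier[OF \<rho>]
      by (intro L.finsum_ldistr) auto
    also have "\<dots> = (\<Oplus>\<phi>\<in>carrier G. t \<otimes> ?y \<phi>)"
      using step y_S tL S_carrier by (intro L.finsum_cong') auto
    also have "\<dots> = t \<otimes> (\<Oplus>\<phi>\<in>carrier G. ?y \<phi>)"
      using y_S tL S_carrier finite_G by (intro L.finsum_rdistr[symmetric]) auto
    finally show ?thesis
      using sum_S[of ?y] y_S by blast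
  qed
  then show "r \<otimes>\<^bsub>\<Lambda>\<^esub> c \<in> scaled_group_ring t"
    using \<Lambda>_mult_closed[OF r c] by (simp add: scaled_group_ring_def)
qed

section \<open>The contradiction from a dual basis\<close>

theorem not_hereditary: "\<not> hereditary \<Lambda>"
proof
  assume her: "hereditary \<Lambda>"
  obtain t where t: "t \<in> S" "t \<noteq> \<zero>" "\<And>\<phi>. \<phi> \<in> carrier G \<Longrightarrow> \<phi> t = t"
    "\<And>\<phi>. \<phi> \<in> carrier G \<Longrightarrow> \<exists>u\<in>S. t = u \<otimes> a \<phi>"
    using exists_invariant_multiple by metis
  then have "\<forall>\<phi>\<in>carrier G. \<exists>u. u \<in> S \<and> t = u \<otimes> a \<phi>"
    by blast
  \<comment> \<open>\<open>u \<phi>\<close> is the quotient of \<open>t\<close> by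
    \<open>a \<phi>\<close>, which lies in \<open>S\<close> by the choice of
    \<open>t\<close>.\<close>
  from bchoice[OF this] obtain u where
    u: "u \<phi> \<in> S" "t = u \<phi> \<otimes> a \<phi>" if "\<phi> \<in> carrier G" for \<phi>
    by auto
  have tL: "t \<in> carrier L"
    using t S_carrier by auto
  have uL: "u \<phi> \<in> carrier L" if "\<phi> \<in> carrier G" for \<phi>
    using u(1)[OF that] S_carrier by auto
  have u_one: "u \<one>\<^bsub>G\<^esub> = t"
    using u(2)[of "\<one>\<^bsub>G\<^esub>"] uL a(3) by simp
  let ?I = "scaled_group_ring t"
  have I: "left_ideal \<Lambda> ?I"
    using t by (intro left_ideal_scaled_group_ring)
  have proj: "projective_left_module \<Lambda> (left_ideal_module \<Lambda> ?I)"
    using her I by (simp add: hereditary_def)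
  \<comment> \<open>The ring axioms of \<open>\<Lambda>\<close> come from the assumed projectivity,
    since \<open>left_module\<close> includes that the scalars form a ring.\<close>
  then interpret \<Lambda>: ring \<Lambda>
    by (simp add: projective_left_module_def left_module_def)
  \<comment> \<open>\<open>e \<phi>\<close> is \<open>t y\<^sub>\<phi>\<close>, in particular \<open>e 1 = t\<close>.\<close>
  define e where "e = (\<lambda>\<phi>. monom (u \<phi>) \<phi>)"
  have e_\<Lambda>: "e \<phi> \<in> carrier \<Lambda>" if "\<phi> \<in> carrier G" for \<phi>
    unfolding e_def using u(1)[OF that] by (rule monom_closed)
  have e_apply: "e \<phi> \<rho> = (if \<rho> = \<phi> then u \<phi> else \<zero>)" if "\<rho> \<in> carrier G" for \<phi> \<rho>
    using that by (simp add: e_def monom_def)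
  have e_I: "e \<phi> \<in> ?I" if "\<phi> \<in> carrier G" for \<phi>
  proof -
    have "\<exists>s\<in>S. e \<phi> \<rho> \<otimes> a \<rho> = t \<otimes> s" if \<rho>: "\<rho> \<in> carrier G" for \<rho>
      using S_closed(1,2) u(2)[OF \<rho>, symmetric] a_carrier[OF \<rho>] tL \<rho>
      by (intro bexI[of _ "if \<rho> = \<phi> then \<one> else \<zero>"]) (auto simp: e_apply)
    then show ?thesis
      using e_\<Lambda>[OF that] by (simp add: scaled_group_ring_def)
  qed
  have u_nz: "u \<phi> \<noteq> \<zero>" if "\<phi> \<in> carrier G" for \<phi>
    using u(2)[OF that] t(2) a_carrier[OF that] by auto
  \<comment> \<open>The dual basis lemma indexes by the generators themselves; injectivity of
    \<open>e\<close> allows sums over them to be rewritten as sums over \<open>G\<close>.\<close>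
  have inj: "inj_on e (carrier G)"
    by (intro inj_onI) (metis e_apply u_nz)
  have gen: "\<exists>m \<in> e ` carrier G \<rightarrow> carrier \<Lambda>. x = (\<Oplus>\<^bsub>\<Lambda>\<^esub>z\<in>e ` carrier G. m z \<otimes>\<^bsub>\<Lambda>\<^esub> z)"
    if x: "x \<in> ?I" for x
  proof -
    have x\<Lambda>: "x \<in> carrier \<Lambda>"
      using x by (simp add: scaled_group_ring_def)
    have "\<forall>\<phi>\<in>carrier G. \<exists>s. s \<in> S \<and> x \<phi> \<otimes> a \<phi> = t \<otimes> s"
      using x by (auto simp: scaled_group_ring_def)
    from bchoice[OF this] obtain s where
      s: "s \<phi> \<in> S" "x \<phi> \<otimes> a \<phi> = t \<otimes> s \<phi>" if "\<phi> \<in> carrier G" for \<phi>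
      by auto
    have x_eq: "x \<phi> = s \<phi> \<otimes> u \<phi>" if \<phi>: "\<phi> \<in> carrier G" for \<phi>
    proof -
      have "x \<phi> \<otimes> a \<phi> = (s \<phi> \<otimes> u \<phi>) \<otimes> a \<phi>"
        using s(2)[OF \<phi>] u(2)[OF \<phi>] uL[OF \<phi>] a_carrier[OF \<phi>] S_carrier[OF s(1)[OF \<phi>]]
        by (simp add: L.m_ac)
      then show ?thesis
        using uL[OF \<phi>] a_carrier[OF \<phi>] a(2)[OF \<phi>] S_carrier[OF s(1)[OF \<phi>]]
          S_carrier[OF \<Lambda>_apply[OF x\<Lambda> \<phi>]]
        by (simp add: L.m_rcancel)
    qed
    \<comment> \<open>The coefficient of the generator \<open>e \<phi>\<close> is the scalar
      \<open>s \<phi>\<close>, realised as \<open>s \<phi> x\<^sub>1\<close>;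
      \<open>inv_into\<close> recovers \<open>\<phi>\<close> from the generator.\<close>
    define m where "m = (\<lambda>z. monom (s (inv_into (carrier G) e z)) \<one>\<^bsub>G\<^esub>)"
    have m_e: "m (e \<phi>) = monom (s \<phi>) \<one>\<^bsub>G\<^esub>" if "\<phi> \<in> carrier G" for \<phi>
      using inj that by (simp add: m_def)
    have m_\<Lambda>: "m (e \<phi>) \<in> carrier \<Lambda>" if "\<phi> \<in> carrier G" for \<phi>
      using monom_closed[OF s(1)] m_e that by simp
    have sum_eq: "(\<Oplus>\<^bsub>\<Lambda>\<^esub>z\<in>e ` carrier G. m z \<otimes>\<^bsub>\<Lambda>\<^esub> z) =
        (\<Oplus>\<^bsub>\<Lambda>\<^esub>\<phi>\<in>carrier G. m (e \<phi>) \<otimes>\<^bsub>\<Lambda>\<^esub> e \<phi>)" (is "?l = ?r")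
      using m_\<Lambda> e_\<Lambda> inj by (intro \<Lambda>.finsum_reindex) auto
    have prod_\<Lambda>: "(\<lambda>\<phi>. m (e \<phi>) \<otimes>\<^bsub>\<Lambda>\<^esub> e \<phi>) \<in> carrier G \<rightarrow> carrier \<Lambda>"
      using m_\<Lambda> e_\<Lambda> by auto
    have "x \<rho> = ?r \<rho>" if \<rho>: "\<rho> \<in> carrier G" for \<rho>
    proof -
      have "?r \<rho> = (\<Oplus>\<phi>\<in>carrier G. (m (e \<phi>) \<otimes>\<^bsub>\<Lambda>\<^esub> e \<phi>) \<rho>)"
        by (rule \<Lambda>_finsum_apply[OF finite_G prod_\<Lambda> \<rho>])
      also have "\<dots> = x \<rho>"
      proof (rule sum_single[OF \<rho>])
        show "x \<rho> \<in> carrier L"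
          by (rule S_carrier[OF \<Lambda>_apply[OF x\<Lambda> \<rho>]])
        fix \<phi> assume \<phi>: "\<phi> \<in> carrier G"
        show "(m (e \<phi>) \<otimes>\<^bsub>\<Lambda>\<^esub> e \<phi>) \<rho> = (if \<phi> = \<rho> then x \<rho> else \<zero>)"
          using one_monom_mult[OF s(1)[OF \<phi>] e_\<Lambda>[OF \<phi>] \<rho>] S_carrier[OF s(1)[OF \<phi>]] x_eq[OF \<phi>]
          by (auto simp: m_e[OF \<phi>] e_apply[OF \<rho>])
      qed
      finally show ?thesis by simp
    qed
    moreover have "?r \<in> carrier \<Lambda>"
      using prod_\<Lambda> by (rule \<Lambda>.finsum_closed)
    ultimately have "x = ?r"
      using x\<Lambda> by (intro PiE_ext[of x "carrier G" "\<lambda>_. S"]) (simp_all add: \<Lambda>_simps)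
    then show ?thesis
      using m_\<Lambda> sum_eq by (intro bexI[of _ m]) auto
  qed
  obtain h where h_closed: "\<And>x z. x \<in> ?I \<Longrightarrow> z \<in> e ` carrier G \<Longrightarrow> h x z \<in> carrier \<Lambda>"
    and h_smult: "\<And>r x z. r \<in> carrier \<Lambda> \<Longrightarrow> x \<in> ?I \<Longrightarrow> z \<in> e ` carrier G \<Longrightarrow>
      h (r \<otimes>\<^bsub>\<Lambda>\<^esub> x) z = r \<otimes>\<^bsub>\<Lambda>\<^esub> h x z"
    and h_sum: "\<And>x. x \<in> ?I \<Longrightarrow> x = (\<Oplus>\<^bsub>\<Lambda>\<^esub>z\<in>e ` carrier G. h x z \<otimes>\<^bsub>\<Lambda>\<^esub> z)"
    using projective_left_ideal_dual_basis[OF proj I _ _ gen] finite_G e_I by blast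
  let ?e1 = "e \<one>\<^bsub>G\<^esub>"
  have e1: "?e1 = monom t \<one>\<^bsub>G\<^esub>"
    by (simp add: e_def u_one)
  \<comment> \<open>\<open>?e1\<close> is the scalar \<open>t\<close>, and \<open>t\<close> is fixed
    by \<open>G\<close>, so it commutes with \<open>e \<tau>\<close>. Since
    \<open>y\<^sub>\<tau>\<close> itself need not lie in \<open>\<Lambda>\<close>, linearity of
    \<open>h\<close> can only be used for \<open>e \<tau> = t y\<^sub>\<tau>\<close>, and this
    commutation makes that enough.\<close>
  have e_comm: "e \<tau> \<otimes>\<^bsub>\<Lambda>\<^esub> ?e1 = ?e1 \<otimes>\<^bsub>\<Lambda>\<^esub> e \<tau>" if \<tau>: "\<tau> \<in> carrier G" for \<tau>
  proof -
    have "(e \<tau> \<otimes>\<^bsub>\<Lambda>\<^esub> ?e1) \<rho> = (?e1 \<otimes>\<^bsub>\<Lambda>\<^esub> e \<tau>) \<rho>" if \<rho>: "\<rho> \<in> carrier G" for \<rho>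
    proof -
      let ?q = "inv\<^bsub>G\<^esub> \<tau> \<otimes>\<^bsub>G\<^esub> \<rho>"
      have q: "?q \<in> carrier G" "\<tau> \<otimes>\<^bsub>G\<^esub> ?q = \<rho>"
        using \<tau> \<rho> by (auto simp: G.m_assoc[symmetric])
      have q1: "?q = \<one>\<^bsub>G\<^esub> \<longleftrightarrow> \<rho> = \<tau>"
        using q \<tau> \<rho> by (metis G.r_one G.l_inv)
      have "(e \<tau> \<otimes>\<^bsub>\<Lambda>\<^esub> ?e1) \<rho> = u \<tau> \<otimes> \<tau> (?e1 ?q) \<otimes> b (\<tau>, ?q)"
        using monom_mult[OF u(1)[OF \<tau>] \<tau> e_\<Lambda>[OF G.one_closed] q(1)] q(2) by (simp add: e_def)
      also have "\<dots> = t \<otimes> e \<tau> \<rho>"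
      proof (cases "\<rho> = \<tau>")
        case True
        then show ?thesis
          using q1 \<tau> \<rho> tL uL[OF \<tau>]
          by (simp add: e_apply[OF G.one_closed] e_apply[OF \<tau>] u_one t(3) b_one_right L.m_comm)
      next
        case False
        then show ?thesis
          using q1 \<tau> \<rho> tL uL[OF \<tau>] S_carrier[OF b(1)[OF \<tau> q(1)]]
          by (simp add: e_apply[OF q(1)] e_apply[OF \<rho>] act_zero)
      qed
      also have "\<dots> = (?e1 \<otimes>\<^bsub>\<Lambda>\<^esub> e \<tau>) \<rho>"
        unfolding e1 by (rule one_monom_mult[OF t(1) e_\<Lambda>[OF \<tau>] \<rho>, symmetric])
      finally show ?thesis .
    qed
    moreover have "e \<tau> \<otimes>\<^bsub>\<Lambda>\<^esub> ?e1 \<in> carrier \<Lambda>" "?e1 \<otimes>\<^bsub>\<Lambda>\<^esub> e \<tau> \<in> carrier \<Lambda>"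
      using e_\<Lambda> \<tau> by auto
    ultimately show ?thesis
      by (intro PiE_ext[of _ "carrier G" "\<lambda>_. S"]) (simp_all add: \<Lambda>_simps)
  qed
  \<comment> \<open>For fixed \<open>\<phi>\<close> the element \<open>h ?e1 (e \<phi>)\<close> is
    one of the right multipliers \<open>q\<close>, and the product considered here is its
    coefficient at \<open>y\<^sub>\<rho>\<close>.\<close>
  have key: "h ?e1 (e \<phi>) \<rho> \<otimes> a \<rho> \<in> P" if \<phi>: "\<phi> \<in> carrier G" and \<rho>: "\<rho> \<in> carrier G" for \<phi> \<rho>
  proof -
    \<comment> \<open>\<open>\<tau>\<close> moves the coefficient at \<open>\<rho>\<close> to the place \<open>\<rho>0\<close>, where the coefficients of elements
      of \<open>\<Lambda>\<close> are divisible by \<open>a \<rho>0\<close>.\<close>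
    define \<tau> where "\<tau> = \<rho>0 \<otimes>\<^bsub>G\<^esub> inv\<^bsub>G\<^esub> \<rho>"
    have \<tau>: "\<tau> \<in> carrier G" "\<tau> \<otimes>\<^bsub>G\<^esub> \<rho> = \<rho>0"
      using \<rho> \<rho>0 by (auto simp: \<tau>_def G.m_assoc)
    let ?d = "h ?e1 (e \<phi>)" and ?d' = "h (e \<tau>) (e \<phi>)"
    have d: "?d \<in> carrier \<Lambda>" "?d' \<in> carrier \<Lambda>"
      using h_closed e_I \<phi> \<tau> by auto
    \<comment> \<open>This says \<open>t (y\<^sub>\<tau> q) = t ?d'\<close> with
      \<open>q = ?d\<close>, so \<open>y\<^sub>\<tau> q\<close> is the element \<open>?d'\<close> of
      \<open>\<Lambda>\<close>.\<close>
    have "e \<tau> \<otimes>\<^bsub>\<Lambda>\<^esub> ?d = h (e \<tau> \<otimes>\<^bsub>\<Lambda>\<^esub> ?e1) (e \<phi>)"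
      using h_smult e_I e_\<Lambda> \<phi> \<tau> by simp
    also have "\<dots> = ?e1 \<otimes>\<^bsub>\<Lambda>\<^esub> ?d'"
      using h_smult e_I e_\<Lambda> \<phi> \<tau> e_comm by simp
    finally have "(e \<tau> \<otimes>\<^bsub>\<Lambda>\<^esub> ?d) \<rho>0 = (?e1 \<otimes>\<^bsub>\<Lambda>\<^esub> ?d') \<rho>0"
      by simp
    moreover have "(e \<tau> \<otimes>\<^bsub>\<Lambda>\<^esub> ?d) \<rho>0 = u \<tau> \<otimes> \<tau> (?d \<rho>) \<otimes> b (\<tau>, \<rho>)"
      using monom_mult[OF u(1)[OF \<tau>(1)] \<tau>(1) d(1) \<rho>] \<tau>(2) by (simp add: e_def)
    moreover have "(?e1 \<otimes>\<^bsub>\<Lambda>\<^esub> ?d') \<rho>0 = t \<otimes> ?d' \<rho>0"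
      using one_monom_mult[OF t(1) d(2) \<rho>0(1)] by (simp add: e1)
    ultimately have eq: "u \<tau> \<otimes> \<tau> (?d \<rho>) \<otimes> b (\<tau>, \<rho>) = t \<otimes> ?d' \<rho>0"
      by simp
    have dL: "?d \<rho> \<in> carrier L" "?d' \<rho>0 \<in> carrier L" "?d \<rho> \<in> S" "?d' \<rho>0 \<in> S"
      using \<Lambda>_apply[OF d(1) \<rho>] \<Lambda>_apply[OF d(2) \<rho>0(1)] S_carrier by auto
    note L = dL(1,2) a_carrier[OF \<tau>(1)] a_carrier[OF \<rho>] a_carrier[OF \<rho>0(1)] uL[OF \<tau>(1)] tL
      S_carrier[OF b(1)[OF \<tau>(1) \<rho>]] act_carrier[OF \<tau>(1) dL(1)]
      act_carrier[OF \<tau>(1) a_carrier[OF \<rho>]]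
    \<comment> \<open>Multiplying the comparison at \<open>\<rho>0\<close> by
      \<open>a \<rho>0\<close> turns \<open>b (\<tau>, \<rho>)\<close> into
      \<open>a \<tau> \<otimes> \<tau> (a \<rho>)\<close>. After cancelling \<open>t\<close>, the
      image under \<open>\<tau>\<close> of the wanted coefficient is a multiple of
      \<open>a \<rho>0\<close>; stability of \<open>P\<close> under the inverse of
      \<open>\<tau>\<close> then removes \<open>\<tau>\<close>.\<close>
    have "t \<otimes> \<tau> (?d \<rho> \<otimes> a \<rho>) = u \<tau> \<otimes> \<tau> (?d \<rho>) \<otimes> (a \<tau> \<otimes> \<tau> (a \<rho>))"
      using L by (simp add: u(2)[OF \<tau>(1)] act_times[OF \<tau>(1)] L.m_ac)
    also have "\<dots> = u \<tau> \<otimes> \<tau> (?d \<rho>) \<otimes> b (\<tau>, \<rho>) \<otimes> a \<rho>0"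
      using b(2)[OF \<tau>(1) \<rho>] L by (simp add: \<tau>(2) L.m_assoc)
    also have "\<dots> = t \<otimes> (?d' \<rho>0 \<otimes> a \<rho>0)"
      using L by (simp add: eq L.m_assoc)
    finally have "\<tau> (?d \<rho> \<otimes> a \<rho>) = a \<rho>0 \<otimes> ?d' \<rho>0"
      using L t(2) act_carrier[OF \<tau>(1)] by (simp add: L.m_lcancel L.m_comm)
    then have "\<tau> (?d \<rho> \<otimes> a \<rho>) \<in> P"
      using P_mult[OF \<rho>0(2)] dL by simp
    then have "(inv\<^bsub>G\<^esub> \<tau>) (\<tau> (?d \<rho> \<otimes> a \<rho>)) \<in> P"
      by (rule act_P[OF G.inv_closed[OF \<tau>(1)]])
    then show ?thesis
      using act_mult[of "inv\<^bsub>G\<^esub> \<tau>" \<tau> "?d \<rho> \<otimes> a \<rho>"] \<tau>(1) L by (simp add: act_one)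
  qed
  \<comment> \<open>In a product with \<open>y\<^sub>\<phi>\<close> on the right, only the
    coefficient at the inverse of \<open>\<phi>\<close> reaches the identity component.\<close>
  let ?p = "\<lambda>\<phi>. h ?e1 (e \<phi>) (inv\<^bsub>G\<^esub> \<phi>) \<otimes> a (inv\<^bsub>G\<^esub> \<phi>)"
  have p: "?p \<phi> \<in> P" if "\<phi> \<in> carrier G" for \<phi>
    using key that by simp
  have h1: "h ?e1 (e \<phi>) \<in> carrier \<Lambda>" if "\<phi> \<in> carrier G" for \<phi>
    using h_closed e_I that by auto
  have coeff: "(h ?e1 (e \<phi>) \<otimes>\<^bsub>\<Lambda>\<^esub> e \<phi>) \<one>\<^bsub>G\<^esub> = t \<otimes> ?p \<phi>" if \<phi>: "\<phi> \<in> carrier G" for \<phi>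
  proof -
    let ?j = "inv\<^bsub>G\<^esub> \<phi>" and ?d = "h ?e1 (e \<phi>)"
    have j: "?j \<in> carrier G" "?j \<otimes>\<^bsub>G\<^esub> \<phi> = \<one>\<^bsub>G\<^esub>"
      using \<phi> by auto
    note L = S_carrier[OF \<Lambda>_apply[OF h1[OF \<phi>] j(1)]] a_carrier[OF j(1)] a_carrier[OF \<phi>] uL[OF \<phi>] tL
      act_carrier[OF j(1) uL[OF \<phi>]] act_carrier[OF j(1) a_carrier[OF \<phi>]] S_carrier[OF b(1)[OF j(1) \<phi>]]
    have "(?d \<otimes>\<^bsub>\<Lambda>\<^esub> e \<phi>) \<one>\<^bsub>G\<^esub> = ?d ?j \<otimes> ?j (u \<phi>) \<otimes> b (?j, \<phi>)"
      using mult_monom[OF u(1)[OF \<phi>] \<phi> h1[OF \<phi>] j(1)] j(2) by (simp add: e_def)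
    also have "b (?j, \<phi>) = a ?j \<otimes> ?j (a \<phi>)"
      using b(2)[OF j(1) \<phi>] a(3) j(2) L by simp
    also have "?d ?j \<otimes> ?j (u \<phi>) \<otimes> (a ?j \<otimes> ?j (a \<phi>)) = ?j (u \<phi> \<otimes> a \<phi>) \<otimes> ?p \<phi>"
      using L by (simp add: act_times[OF j(1)] L.m_ac)
    also have "?j (u \<phi> \<otimes> a \<phi>) = t"
      using u(2)[OF \<phi>] t(3)[OF j(1)] by simp
    finally show ?thesis .
  qed
  have prod_\<Lambda>: "(\<lambda>\<phi>. h ?e1 (e \<phi>) \<otimes>\<^bsub>\<Lambda>\<^esub> e \<phi>) \<in> carrier G \<rightarrow> carrier \<Lambda>"
    using h1 e_\<Lambda> by auto
  have "?e1 = (\<Oplus>\<^bsub>\<Lambda>\<^esub>z\<in>e ` carrier G. h ?e1 z \<otimes>\<^bsub>\<Lambda>\<^esub> z)"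
    using h_sum e_I by simp
  also have "\<dots> = (\<Oplus>\<^bsub>\<Lambda>\<^esub>\<phi>\<in>carrier G. h ?e1 (e \<phi>) \<otimes>\<^bsub>\<Lambda>\<^esub> e \<phi>)"
    using h1 e_\<Lambda> inj by (intro \<Lambda>.finsum_reindex) auto
  finally have "?e1 \<one>\<^bsub>G\<^esub> = (\<Oplus>\<phi>\<in>carrier G. (h ?e1 (e \<phi>) \<otimes>\<^bsub>\<Lambda>\<^esub> e \<phi>) \<one>\<^bsub>G\<^esub>)"
    using \<Lambda>_finsum_apply[OF finite_G prod_\<Lambda> G.one_closed] by simp
  also have "\<dots> = (\<Oplus>\<phi>\<in>carrier G. t \<otimes> ?p \<phi>)"
    using coeff p P_S S_carrier tL by (intro L.finsum_cong') auto
  also have "\<dots> = t \<otimes> (\<Oplus>\<phi>\<in>carrier G. ?p \<phi>)"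
    using p P_S S_carrier tL finite_G by (intro L.finsum_rdistr[symmetric]) auto
  \<comment> \<open>Both sides are the identity coefficient of \<open>?e1\<close>, once directly and
    once through the dual basis expansion. Writing the left side as
    \<open>t \<otimes> \<one>\<close> prepares the cancellation of \<open>t\<close>.\<close>
  finally have t_eq: "t \<otimes> \<one> = t \<otimes> (\<Oplus>\<phi>\<in>carrier G. ?p \<phi>)"
    using tL by (simp add: e_apply[OF G.one_closed] u_one)
  have sum_P: "(\<Oplus>\<phi>\<in>carrier G. ?p \<phi>) \<in> P"
    using p by (intro P_sum) auto
  have "\<one> = (\<Oplus>\<phi>\<in>carrier G. ?p \<phi>)"
    using t_eq unfolding L.m_lcancel[OF t(2) tL L.one_closed S_carrier[OF P_S[OF sum_P]]] .
  then show False
    using P(2) sum_P by simp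
qed

end


section \<open>From the unramified Galois extension to the abstract setting\<close>

theorem corollary3p5:
  fixes L :: "('a, 'm) ring_scheme"
    and R K S :: "'a set"
    and G :: "('a \<Rightarrow> 'a) monoid"
    and b :: "('a \<Rightarrow> 'a) \<times> ('a \<Rightarrow> 'a) \<Rightarrow> 'a"
  assumes "finite_galois_extension L K"
    and "subring R L"
    and "complete_discrete_valuation_ring (L\<lparr>carrier := R\<rparr>)"
    and "K = fractions L R"
    and "S = integral_closure L R"
    and "unramified_finite_residue L R S"
    and "G = galois_group L K"
    and "b \<in> coboundaries L G S"
    and "inertial_group L G S b \<subset> carrier G"
  shows "\<not> hereditary (weak_crossed_product L G S b)"
proof -
  have L: "field L" "subfield K L" "ring.finite_dimension L K (carrier L)"
    using assms(1) by (auto simp: finite_galois_extension_def)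
  interpret L: field L by fact
  interpret G: group G
    unfolding assms(7) using L by (intro group_galois_group)
  let ?S = "L\<lparr>carrier := S\<rparr>" and ?M = "max_ideal (L\<lparr>carrier := R\<rparr>)"
  define P where "P = genideal ?S ?M"
  have "discrete_valuation_ring (L\<lparr>carrier := R\<rparr>)"
    using assms(3) by (simp add: complete_discrete_valuation_ring_def)
  note local = unramified_integral_closure[OF L(1) assms(2) this assms(5,6) P_def]
  note Sc = subringE[OF local(1)]
  interpret P: maximalideal P ?S by (rule local(2))
  have S_cring: "cring ?S"
    using L.subring_is_domain[OF local(1)] by (simp add: domain_def)
  \<comment> \<open>Automorphisms over \<open>K\<close> hence fix \<open>R\<close> pointwise, which
    is what makes them preserve both \<open>S\<close> and the ideal \<open>P\<close> generated by
    \<open>?M\<close>.\<close>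
  have R_K: "R \<subseteq> K"
  proof
    fix r assume r: "r \<in> R"
    then have "r = r \<otimes>\<^bsub>L\<^esub> inv\<^bsub>L\<^esub> \<one>\<^bsub>L\<^esub>"
      using subringE(1)[OF assms(2)] by auto
    then show "r \<in> K"
      using r subringE(3)[OF assms(2)] unfolding assms(4) fractions_def by fastforce
  qed
  note mem = galois_group_mem[where L = L and K = K, folded assms(7)]
  have act_S: "\<sigma> x \<in> S" if "\<sigma> \<in> carrier G" "x \<in> S" for \<sigma> x
    using L.integral_closure_hom_closed[OF mem(2)[OF that(1)] _ assms(2)] mem(4)[OF that(1)] R_K
      that(2) assms(5) by blast
  have act_P: "\<sigma> x \<in> P" if s: "\<sigma> \<in> carrier G" and x: "x \<in> P" for \<sigma> x
    unfolding P_def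
  proof (rule genideal_hom_closed[OF S_cring, of \<sigma> ?M x])
    show "\<sigma> \<in> ring_hom ?S ?S"
      using mem(2)[OF s] act_S[OF s] Sc(1) by (auto simp: ring_hom_def subset_iff)
    show "?M \<subseteq> carrier ?S"
      using local(4,5) by auto
    show "\<sigma> y = y" if "y \<in> ?M" for y
      using that local(4) R_K mem(4)[OF s] by blast
    show "x \<in> genideal ?S ?M"
      using x by (simp add: P_def)
  qed
  obtain a where a: "a \<in> carrier G \<rightarrow> S - {\<zero>\<^bsub>L\<^esub>}" "a \<one>\<^bsub>G\<^esub> = \<one>\<^bsub>L\<^esub>"
    and b: "b \<in> carrier G \<times> carrier G \<rightarrow> S - {\<zero>\<^bsub>L\<^esub>}"
    and b_eq: "\<And>\<sigma> \<tau>. \<sigma> \<in> carrier G \<Longrightarrow> \<tau> \<in> carrier G \<Longrightarrow>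
      b (\<sigma>, \<tau>) = a \<sigma> \<otimes>\<^bsub>L\<^esub> \<sigma> (a \<tau>) \<otimes>\<^bsub>L\<^esub> inv\<^bsub>L\<^esub> (a (\<sigma> \<otimes>\<^bsub>G\<^esub> \<tau>))"
    using assms(8) by (auto simp: coboundaries_def)
  have aS: "a \<sigma> \<in> S" "a \<sigma> \<noteq> \<zero>\<^bsub>L\<^esub>" "a \<sigma> \<in> carrier L" if "\<sigma> \<in> carrier G" for \<sigma>
    using a(1) Sc(1) that by auto
  have coboundary: "b (\<sigma>, \<tau>) \<otimes>\<^bsub>L\<^esub> a (\<sigma> \<otimes>\<^bsub>G\<^esub> \<tau>) = a \<sigma> \<otimes>\<^bsub>L\<^esub> \<sigma> (a \<tau>)"
    if "\<sigma> \<in> carrier G" "\<tau> \<in> carrier G" for \<sigma> \<tau>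
  proof -
    have "a (\<sigma> \<otimes>\<^bsub>G\<^esub> \<tau>) \<in> Units L"
      using aS[of "\<sigma> \<otimes>\<^bsub>G\<^esub> \<tau>"] that by (simp add: L.field_Units)
    moreover have "\<sigma> (a \<tau>) \<in> carrier L"
      using act_S[OF that(1) aS(1)[OF that(2)]] Sc(1) by blast
    ultimately show ?thesis
      using aS(3) that by (simp add: b_eq L.m_assoc)
  qed
  obtain \<sigma> where \<sigma>: "\<sigma> \<in> carrier G" "b (\<sigma>, inv\<^bsub>G\<^esub> \<sigma>) \<notin> Units ?S"
    using assms(9) by (auto simp: inertial_group_def)
  have bS: "b (\<sigma>, inv\<^bsub>G\<^esub> \<sigma>) \<in> S"
    using b \<sigma>(1) by auto
  then have "b (\<sigma>, inv\<^bsub>G\<^esub> \<sigma>) \<in> P"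
    using local(3) \<sigma>(2) by blast
  then have "a \<sigma> \<otimes>\<^bsub>L\<^esub> \<sigma> (a (inv\<^bsub>G\<^esub> \<sigma>)) \<in> P"
    using coboundary[of \<sigma> "inv\<^bsub>G\<^esub> \<sigma>"] \<sigma>(1) a(2) bS Sc(1) by auto
  moreover have "primeideal P ?S"
    using cring.maximalideal_prime[OF S_cring local(2)] .
  ultimately have "a \<sigma> \<in> P \<or> \<sigma> (a (inv\<^bsub>G\<^esub> \<sigma>)) \<in> P"
    using primeideal.I_prime[of P ?S "a \<sigma>" "\<sigma> (a (inv\<^bsub>G\<^esub> \<sigma>))"] aS(1) act_S \<sigma>(1) by simp
  then obtain \<rho> where \<rho>: "\<rho> \<in> carrier G" "a \<rho> \<in> P"
  proof
    \<comment> \<open>Here \<open>\<rho>\<close> is the inverse of \<open>\<sigma>\<close>: applying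
      that inverse strips \<open>\<sigma>\<close> from the factor and keeps it in
      \<open>P\<close>.\<close>
    assume *: "\<sigma> (a (inv\<^bsub>G\<^esub> \<sigma>)) \<in> P"
    have "(inv\<^bsub>G\<^esub> \<sigma>) (\<sigma> (a (inv\<^bsub>G\<^esub> \<sigma>))) = a (inv\<^bsub>G\<^esub> \<sigma>)"
      using galois_group_mult[where L = L and K = K, folded assms(7), of "inv\<^bsub>G\<^esub> \<sigma>" \<sigma>]
        galois_group_one[where L = L and K = K, folded assms(7)] aS(3)[of "inv\<^bsub>G\<^esub> \<sigma>"] \<sigma>(1)
      by (metis G.inv_closed G.l_inv)
    then have "a (inv\<^bsub>G\<^esub> \<sigma>) \<in> P"
      using act_P[OF G.inv_closed[OF \<sigma>(1)] *] by simp
    then show ?thesis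
      using that \<sigma>(1) by blast
  qed (use that \<sigma>(1) in blast)
  have one_P: "\<one>\<^bsub>L\<^esub> \<notin> P"
    using P.one_imp_carrier P.I_notcarr by auto
  have finite: "finite (carrier G)"
    unfolding assms(7) using L by (intro finite_galois_group)
  have "coboundary_order L G S P a b \<rho>"
  proof (intro coboundary_order.intro coboundary_order_axioms.intro)
    show "(\<sigma> \<otimes>\<^bsub>G\<^esub> \<tau>) x = \<sigma> (\<tau> x)"
      if "\<sigma> \<in> carrier G" "\<tau> \<in> carrier G" "x \<in> carrier L" for \<sigma> \<tau> x
      using that unfolding assms(7) by (rule galois_group_mult)
    show "\<one>\<^bsub>G\<^esub> x = x" if "x \<in> carrier L" for x
      using that unfolding assms(7) by (rule galois_group_one)
    show "b (\<sigma>, \<tau>) \<in> S" if "\<sigma> \<in> carrier G" "\<tau> \<in> carrier G" for \<sigma> \<tau>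
      using b that by auto
  qed (fact L.field_axioms G.group_axioms finite mem(2) local(1) act_S P.is_ideal one_P act_P aS(1,2)
      a(2) coboundary \<rho>)+
  then show ?thesis
    by (rule coboundary_order.not_hereditary)
qed

end
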